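(* For $0\le t\le\pi/3$ let $\mathcal{B}_t=(\Gamma_t,\mathcal{E}_t)$ be the Brocard porism in which $\Gamma_t$ is the circle with center $\left(0,\frac{\sin t}{2(\cos t-1)}\right)$ and radius $\sqrt{\frac{2\cos t-1}{2(1-\cos t)}}$, and $\mathcal{E}_t$ is the axis-aligned ellipse with center $(0,-\sin t)$, horizontal semi-axis $\frac{\sqrt{2\cos t-1}}{2}$ and vertical semi-axis $\frac{\sqrt{(2\cos t-1)(1-\cos t)}}{\sqrt2}$. Let $\sigma=\cot\omega$, where $\omega$ is the Brocard angle of the 3-periodics of $\mathcal{B}_t$, and $\sigma'=\cot\omega'$, where $\omega'$ is the Brocard angle of their second Brocard triangles. Then the family of second Brocard triangles of $\mathcal{B}_t$ are the 3-periodics of a distinct porism $\mathcal{B}_{t'}$, $t'>t$, such that $$\cot t'=\sigma'=\frac{4-4\cos t+\cos 2t}{4\sin t-\sin 2t}=\frac{\sigma^2+3}{2\sigma}.$$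
   Context: For a triangle $T=ABC$ with vertices labelled counterclockwise, the Brocard angle $\omega$ and Brocard points $\Omega_1,\Omega_2$ are defined by $\angle\Omega_1AB=\angle\Omega_1BC=\angle\Omega_1CA=\omega$ and $\angle\Omega_2BA=\angle\Omega_2CB=\angle\Omega_2AC=\omega$. $X_3$ is the circumcenter and $X_6$ the symmedian point. The Brocard circle $\mathcal{K}$ is the circle through $X_3,\Omega_1,\Omega_2$; it has $X_3X_6$ as a diameter. The Brocard inellipse is the ellipse tangent to the three sides with foci $\Omega_1,\Omega_2$. A Brocard porism is the pair $(\Gamma,\mathcal{E})$ of circumcircle and Brocard inellipse of a triangle; its 3-periodics are all triangles inscribed in $\Gamma$ and circumscribed about $\mathcal{E}$. All of them have the same Brocard angle. The second Brocard triangle $T'=A'B'C'$ of $T=ABC$: $A'$ is the intersection, other than $X_6$, of the line $AX_6$ with $\mathcal{K}$ (and $A'=X_6$ if the line is tangent to $\mathcal{K}$), similarly $B'$ and $C'$.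
   Formalization: The printed chain fails for every t, since σ = cot(t/2): here cot t' equals the trigonometric fraction, while σ' = cot(t'/2) = (σ²+3)/(2σ). Excluded: t = 0 (Γ_t undefined) and t = π/3 (both conics shrink to a point, t' > t fails). *)

theory Defs
  imports "HOL-Analysis.Analysis"
begin

text \<open>The Euclidean plane is the type \<^typ>\<open>complex\<close>. A triangle is a labelled triple of
  non-collinear points, of either orientation: reversing the orientation of the labelling
  exchanges the two Brocard points below and leaves the Brocard angle unchanged. (The labelled
  triangle \<open>A'B'C'\<close> built from a counterclockwise \<open>ABC\<close> is clockwise.)\<close>

type_synonym triangle = "complex \<times> complex \<times> complex"

text \<open>The unsigned angle at the vertex \<open>Q\<close>, in \<open>[0, \<pi>]\<close>.\<close>

definition angle :: "complex \<Rightarrow> complex \<Rightarrow> complex \<Rightarrow> real" where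
  "angle P Q R = arccos (((P - Q) \<bullet> (R - Q)) / (norm (P - Q) * norm (R - Q)))"

definition circumcenter :: "triangle \<Rightarrow> complex" where
  "circumcenter = (\<lambda>(A, B, C). THE X. dist X A = dist X B \<and> dist X B = dist X C)"

definition circumcircle :: "triangle \<Rightarrow> complex set" where
  "circumcircle = (\<lambda>(A, B, C). sphere (circumcenter (A, B, C)) (dist (circumcenter (A, B, C)) A))"

text \<open>The symmedian point has barycentric coordinates \<open>a\<^sup>2 : b\<^sup>2 : c\<^sup>2\<close> (trilinears \<open>a : b : c\<close>),
  where \<open>a\<close>, \<open>b\<close>, \<open>c\<close> are the lengths of the sides opposite \<open>A\<close>, \<open>B\<close>, \<open>C\<close>.\<close>

definition symmedian_point :: "triangle \<Rightarrow> complex" where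
  "symmedian_point = (\<lambda>(A, B, C).
     ((dist B C)\<^sup>2 *\<^sub>R A + (dist C A)\<^sup>2 *\<^sub>R B + (dist A B)\<^sup>2 *\<^sub>R C) /\<^sub>R
     ((dist B C)\<^sup>2 + (dist C A)\<^sup>2 + (dist A B)\<^sup>2))"

text \<open>Since \<^const>\<open>angle\<close> is unsigned, the Brocard points are required to lie inside the triangle.\<close>

definition brocard :: "triangle \<Rightarrow> complex \<Rightarrow> complex \<Rightarrow> real \<Rightarrow> bool" where
  "brocard = (\<lambda>(A, B, C) P Q w.
     P \<in> interior (convex hull {A, B, C}) \<and> Q \<in> interior (convex hull {A, B, C}) \<and>
     angle P A B = w \<and> angle P B C = w \<and> angle P C A = w \<and>
     angle Q B A = w \<and> angle Q C B = w \<and> angle Q A C = w)"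

definition brocard_point1 :: "triangle \<Rightarrow> complex" where
  "brocard_point1 T = (THE P. \<exists>Q w. brocard T P Q w)"

definition brocard_point2 :: "triangle \<Rightarrow> complex" where
  "brocard_point2 T = (THE Q. \<exists>P w. brocard T P Q w)"

definition brocard_angle :: "triangle \<Rightarrow> real" where
  "brocard_angle T = (THE w. \<exists>P Q. brocard T P Q w)"

text \<open>Not meaningful for equilateral triangles, for which the three defining points coincide.\<close>

definition brocard_circle :: "triangle \<Rightarrow> complex set" where
  "brocard_circle T = (THE K. (\<exists>c r. r > 0 \<and> K = sphere c r) \<and>
     circumcenter T \<in> K \<and> brocard_point1 T \<in> K \<and> brocard_point2 T \<in> K)"

text \<open>A line is tangent to an ellipse iff it meets it in exactly one point; the point of tangency
  has to lie on the side itself, which excludes exscribed ellipses.\<close>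

definition tangent_side :: "complex \<Rightarrow> complex \<Rightarrow> complex set \<Rightarrow> bool" where
  "tangent_side A B E \<longleftrightarrow> (\<exists>P \<in> closed_segment A B. affine hull {A, B} \<inter> E = {P})"

definition circumscribed :: "triangle \<Rightarrow> complex set \<Rightarrow> bool" where
  "circumscribed = (\<lambda>(A, B, C) E. tangent_side A B E \<and> tangent_side B C E \<and> tangent_side C A E)"

definition brocard_inellipse :: "triangle \<Rightarrow> complex set" where
  "brocard_inellipse T = (THE E.
     (\<exists>s > dist (brocard_point1 T) (brocard_point2 T).
        E = {P. dist P (brocard_point1 T) + dist P (brocard_point2 T) = s}) \<and>
     circumscribed T E)"

definition second_brocard_vertex :: "triangle \<Rightarrow> complex \<Rightarrow> complex" where
  "second_brocard_vertex T V =
     (let X6 = symmedian_point T; S = affine hull {V, X6} \<inter> brocard_circle T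
      in if S = {X6} then X6 else (THE P. P \<in> S \<and> P \<noteq> X6))"

definition second_brocard_triangle :: "triangle \<Rightarrow> triangle" where
  "second_brocard_triangle = (\<lambda>(A, B, C).
     (second_brocard_vertex (A, B, C) A, second_brocard_vertex (A, B, C) B,
      second_brocard_vertex (A, B, C) C))"

definition brocard_porism :: "complex set \<times> complex set \<Rightarrow> bool" where
  "brocard_porism = (\<lambda>(\<Gamma>, E). \<exists>A B C. \<not> collinear {A, B, C} \<and>
     \<Gamma> = circumcircle (A, B, C) \<and> E = brocard_inellipse (A, B, C))"

definition three_periodics :: "complex set \<times> complex set \<Rightarrow> triangle set" where
  "three_periodics = (\<lambda>(\<Gamma>, E). {(A, B, C). \<not> collinear {A, B, C} \<and>
     A \<in> \<Gamma> \<and> B \<in> \<Gamma> \<and> C \<in> \<Gamma> \<and> circumscribed (A, B, C) E})"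

definition axis_ellipse :: "complex \<Rightarrow> real \<Rightarrow> real \<Rightarrow> complex set" where
  "axis_ellipse c a b = {P. (Re (P - c) / a)\<^sup>2 + (Im (P - c) / b)\<^sup>2 = 1}"

definition porism_B :: "real \<Rightarrow> complex set \<times> complex set" where
  "porism_B t =
     (sphere (Complex 0 (sin t / (2 * (cos t - 1)))) (sqrt ((2 * cos t - 1) / (2 * (1 - cos t)))),
      axis_ellipse (Complex 0 (- sin t)) (sqrt (2 * cos t - 1) / 2)
        (sqrt ((2 * cos t - 1) * (1 - cos t)) / sqrt 2))"

end

theory Submission
  imports Defs
begin

text \<open>
  Put \<open>u = cot (t / 2)\<close> and \<open>v = sqrt (u\<^sup>2 - 3)\<close>. The projective map \<open>proj_map u v\<close> takes the unit
  circle to \<open>\<Gamma>\<^sub>t\<close> and the concentric circle of radius \<open>1/2\<close> to \<open>E\<^sub>t\<close>, so the 3-periodics are exactly the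
  images of the equilateral triangles \<open>x, y, z\<close> inscribed in the unit circle. The squared sides of
  such an image are proportional to the denominators of the map at the opposite vertices, which
  makes all barycentric data explicit: the cotangent of the Brocard angle is \<open>u\<close>, the Brocard points
  are the foci of \<open>E\<^sub>t\<close>, the symmedian point is fixed, and the Brocard circle is the outer circle of the
  porism with parameter \<open>u' = (u\<^sup>2 + 3) / (2 u)\<close>. Intersecting lines with this circle, the second
  Brocard triangle of the image of \<open>x, y, z\<close> under \<open>proj_map u v\<close> is the image of
  \<open>-x\<^sup>2, -y\<^sup>2, -z\<^sup>2\<close> under the map with parameter \<open>u'\<close>, and \<open>z \<mapsto> -z\<^sup>2\<close> maps the inscribed
  equilateral triangles onto themselves.
\<close>

section \<open>Brocard points of an arbitrary triangle\<close>

text \<open>Twice the signed area of the triangle, positive for a counterclockwise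
  labelling.\<close>

definition cross :: "complex \<Rightarrow> complex \<Rightarrow> complex \<Rightarrow> real" where
  "cross A B C = Re (B - A) * Im (C - A) - Im (B - A) * Re (C - A)"

lemma collinear_iff_cross: "collinear {A, B, C} \<longleftrightarrow> cross A B C = 0"
proof -
  have "collinear {A, B, C} \<longleftrightarrow> collinear {0, B - A, C - A}"
    using collinear_3[of B A C] by (subst insert_commute) (simp only: NO_MATCH_def simp_thms)
  also have "\<dots> \<longleftrightarrow> cross A B C = 0"
  proof
    assume "collinear {0, B - A, C - A}"
    then consider "B - A = 0" | "C - A = 0" | k where "C - A = k *\<^sub>R (B - A)"
      unfolding collinear_lemma by blast
    then show "cross A B C = 0"
    proof cases
      case 3
      then have "Re (C - A) = k * Re (B - A)" "Im (C - A) = k * Im (B - A)" by simp_all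
      then show ?thesis unfolding cross_def by simp
    qed (simp_all add: cross_def)
  next
    assume z: "cross A B C = 0"
    define u v where "u = B - A" and "v = C - A"
    have uv: "Re u * Im v = Im u * Re v" using z by (simp add: cross_def u_def v_def)
    \<comment> \<open>Lagrange's identity: a vanishing cross product is the equality case of
      Cauchy-Schwarz.\<close>
    have "(u \<bullet> v)\<^sup>2 + (Re u * Im v - Im u * Re v)\<^sup>2 = (norm u * norm v)\<^sup>2"
      unfolding power_mult_distrib cmod_power2 inner_complex_def
      by (simp add: power2_eq_square algebra_simps)
    then have "\<bar>u \<bullet> v\<bar> = norm u * norm v"
      using uv by (subst power2_eq_iff_nonneg[symmetric]) simp_all
    then show "collinear {0, B - A, C - A}"
      unfolding norm_cauchy_schwarz_equal u_def v_def by simp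
  qed
  finally show ?thesis .
qed

lemma cross_rotate: "cross B C A = cross A B C" "cross C A B = cross A B C"
  by (simp_all add: cross_def algebra_simps)

lemma cross_swap: "cross B A C = - cross A B C"
  by (simp add: cross_def algebra_simps)

section \<open>Angles expressed by their cotangents\<close>

definition acot :: "real \<Rightarrow> real" where
  "acot k = arccos (k / sqrt (k\<^sup>2 + 1))"

lemma cot_acot: "cot (acot k) = k"
proof -
  have p: "k\<^sup>2 + 1 > 0" by (simp add: add_nonneg_pos)
  have q: "sqrt (k\<^sup>2 + 1) > 0" using p by simp
  have s: "(k / sqrt (k\<^sup>2 + 1))\<^sup>2 = k\<^sup>2 / (k\<^sup>2 + 1)"
    using p by (simp add: power_divide)
  have "(k / sqrt (k\<^sup>2 + 1))\<^sup>2 \<le> 1" unfolding s using p by simp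
  then have b: "- 1 \<le> k / sqrt (k\<^sup>2 + 1)" "k / sqrt (k\<^sup>2 + 1) \<le> 1"
    unfolding abs_square_le_1 by linarith+
  have "sin (acot k) = sqrt (1 / (k\<^sup>2 + 1))"
    unfolding acot_def sin_arccos[OF b] s using p by (simp add: field_simps)
  moreover have "cos (acot k) = k / sqrt (k\<^sup>2 + 1)"
    unfolding acot_def using b by (rule cos_arccos)
  ultimately show ?thesis using q by (simp add: cot_def real_sqrt_divide)
qed

text \<open>By Lagrange's identity the product of the two norms is \<open>sqrt (p^2 + q^2)\<close>,
  with \<open>p\<close> the inner product and \<open>q\<close> the absolute cross product. Dividing
  by \<open>q\<close> turns the arccos into \<open>acot (p / q)\<close>, so equations between angles
  become rational equations in the coordinates.\<close>

lemma angle_eq_acot: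
  assumes "cross Q R P \<noteq> 0"
  shows "angle P Q R = acot ((P - Q) \<bullet> (R - Q) / \<bar>cross Q R P\<bar>)"
proof -
  define p q where "p = (P - Q) \<bullet> (R - Q)" and "q = \<bar>cross Q R P\<bar>"
  have q: "q > 0" using assms by (simp add: q_def)
  have "(norm (P - Q) * norm (R - Q))\<^sup>2 = p\<^sup>2 + q\<^sup>2"
    unfolding p_def q_def power_mult_distrib cmod_power2 inner_complex_def cross_def power2_abs
    by (simp add: power2_eq_square algebra_simps)
  then have "norm (P - Q) * norm (R - Q) = sqrt (p\<^sup>2 + q\<^sup>2)"
    by (rule real_sqrt_unique[symmetric]) simp_all
  also have "p\<^sup>2 + q\<^sup>2 = q\<^sup>2 * ((p / q)\<^sup>2 + 1)"
    using q by (simp add: field_simps)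
  also have "sqrt (q\<^sup>2 * ((p / q)\<^sup>2 + 1)) = q * sqrt ((p / q)\<^sup>2 + 1)"
    using q by (simp add: real_sqrt_mult)
  finally have n: "norm (P - Q) * norm (R - Q) = q * sqrt ((p / q)\<^sup>2 + 1)" .
  have "(P - Q) \<bullet> (R - Q) / (norm (P - Q) * norm (R - Q)) = (p / q) / sqrt ((p / q)\<^sup>2 + 1)"
    unfolding n p_def[symmetric] by simp
  then show ?thesis by (simp only: angle_def acot_def p_def q_def)
qed

lemma acot_eq_iff: "acot x = acot y \<longleftrightarrow> x = y"
  by (metis cot_acot)

text \<open>Exchanging \<open>A\<close> and \<open>B\<close> turns the conditions on the second
  Brocard point into those on the first, so only one half has to be solved.\<close>

definition brocard_half :: "complex \<Rightarrow> complex \<Rightarrow> complex \<Rightarrow> complex \<Rightarrow> real \<Rightarrow> bool" where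
  "brocard_half A B C P w \<longleftrightarrow> P \<in> interior (convex hull {A, B, C}) \<and>
     angle P A B = w \<and> angle P B C = w \<and> angle P C A = w"

lemma brocard_iff_half:
  "brocard (A, B, C) P Q w \<longleftrightarrow> brocard_half A B C P w \<and> brocard_half B A C Q w"
  by (auto simp: brocard_def brocard_half_def insert_commute)

text \<open>The classical formula: the sum of the squared sides over four times the area.\<close>

definition brocard_cot :: "complex \<Rightarrow> complex \<Rightarrow> complex \<Rightarrow> real" where
  "brocard_cot A B C =
     ((dist B C)\<^sup>2 + (dist C A)\<^sup>2 + (dist A B)\<^sup>2) / (2 * \<bar>cross A B C\<bar>)"

text \<open>The barycentric weights \<open>1/b^2 : 1/c^2 : 1/a^2\<close> of the first Brocard point,
  cleared of denominators.\<close>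

definition brocard_center :: "complex \<Rightarrow> complex \<Rightarrow> complex \<Rightarrow> complex" where
  "brocard_center A B C =
     (((dist A B)\<^sup>2 * (dist B C)\<^sup>2) *\<^sub>R A + ((dist B C)\<^sup>2 * (dist C A)\<^sup>2) *\<^sub>R B
       + ((dist C A)\<^sup>2 * (dist A B)\<^sup>2) *\<^sub>R C) /\<^sub>R
     ((dist A B)\<^sup>2 * (dist B C)\<^sup>2 + (dist B C)\<^sup>2 * (dist C A)\<^sup>2 + (dist C A)\<^sup>2 * (dist A B)\<^sup>2)"

lemma dist_sq_complex: "(dist A B)\<^sup>2 = (Re A - Re B)\<^sup>2 + (Im A - Im B)\<^sup>2"
  by (simp add: dist_norm cmod_power2)

section \<open>The angle conditions in barycentric coordinates\<close>

lemma barycentric_inner: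
  fixes A B C P :: complex
  assumes "x + y + z = 1" and P: "P = x *\<^sub>R A + y *\<^sub>R B + z *\<^sub>R C"
  shows "(P - A) \<bullet> (B - A) =
    y * (dist A B)\<^sup>2 + z * ((dist C A)\<^sup>2 + (dist A B)\<^sup>2 - (dist B C)\<^sup>2) / 2"
proof -
  have x: "x = 1 - y - z" using assms by simp
  show ?thesis unfolding P x dist_sq_complex inner_complex_def
    by (simp add: field_simps power2_eq_square)
qed

lemma barycentric_cross:
  assumes "x + y + z = 1" and P: "P = x *\<^sub>R A + y *\<^sub>R B + z *\<^sub>R C"
  shows "cross A B P = z * cross A B C"
proof -
  have x: "x = 1 - y - z" using assms by simp
  show ?thesis unfolding P x cross_def by (simp add: algebra_simps)
qed

text \<open>The inner product is linear in \<open>y\<close> and \<open>z\<close> by the law of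
  cosines, and the cross product is \<open>z\<close> times that of the triangle. With
  \<open>z > 0\<close> the cotangent equation can therefore be cleared to a linear one.\<close>

lemma barycentric_angle:
  assumes D: "cross A B C \<noteq> 0" and "x + y + z = 1" and "z > 0"
    and P: "P = x *\<^sub>R A + y *\<^sub>R B + z *\<^sub>R C"
  shows "angle P A B = acot k \<longleftrightarrow>
    y * (dist A B)\<^sup>2 + z * ((dist C A)\<^sup>2 + (dist A B)\<^sup>2 - (dist B C)\<^sup>2) / 2 = k * \<bar>cross A B C\<bar> * z"
proof -
  have c: "cross A B P = z * cross A B C" using assms by (intro barycentric_cross)
  have i: "(P - A) \<bullet> (B - A) =
    y * (dist A B)\<^sup>2 + z * ((dist C A)\<^sup>2 + (dist A B)\<^sup>2 - (dist B C)\<^sup>2) / 2"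
    using assms by (intro barycentric_inner)
  have "cross A B P \<noteq> 0" using c D \<open>z > 0\<close> by simp
  then have "angle P A B = acot k \<longleftrightarrow> (P - A) \<bullet> (B - A) / \<bar>cross A B P\<bar> = k"
    by (simp add: angle_eq_acot acot_eq_iff)
  also have "\<dots> \<longleftrightarrow> (P - A) \<bullet> (B - A) = k * \<bar>cross A B C\<bar> * z"
    unfolding c using D \<open>z > 0\<close> by (simp add: abs_mult divide_eq_eq mult_ac)
  finally show ?thesis unfolding i .
qed

text \<open>In barycentric coordinates the three angle conditions are linear; their sum determines the
  angle, and after that they only say how the coordinates are proportional.\<close>

lemma barycentric_system_iff:
  fixes a b c k x y z :: real
  assumes s: "x + y + z = 1"
  shows "y * c + z * (b + c - a) / 2 = k * z \<and> z * a + x * (c + a - b) / 2 = k * x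
      \<and> x * b + y * (a + b - c) / 2 = k * y
    \<longleftrightarrow> k = (a + b + c) / 2 \<and> y * c = z * a \<and> z * a = x * b" (is "?L \<longleftrightarrow> ?R")
proof
  assume L: ?L
  have "(x + y + z) * (a + b + c) / 2 = k * (x + y + z)"
    using L by (simp add: algebra_simps add_divide_distrib diff_divide_distrib)
  then have k: "k = (a + b + c) / 2" using s by simp
  have "2 * (y * c) + z * (b + c - a) = 2 * k * z" "2 * (x * b) + y * (a + b - c) = 2 * k * y"
    "2 * (z * a) + x * (c + a - b) = 2 * k * x"
    using L by (simp_all add: field_simps)
  moreover have "2 * k = a + b + c" using k by simp
  ultimately show ?R using k by algebra
next
  assume R: ?R
  have "2 * (y * c) + z * (b + c - a) = 2 * k * z" "2 * (x * b) + y * (a + b - c) = 2 * k * y"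
    "2 * (z * a) + x * (c + a - b) = 2 * k * x"
    using R by (simp_all add: algebra_simps)
  then show ?L by (simp add: field_simps)
qed

lemma cross_neq_0_imp_dist:
  assumes "cross A B C \<noteq> 0"
  shows "dist A B > 0" "dist B C > 0" "dist C A > 0"
  using assms by (auto simp: cross_def algebra_simps)

text \<open>Interior points are those with positive normalized barycentric coordinates. The three
  angle conditions are cyclic copies of one linear equation, and the resulting system has exactly
  one normalized solution, with weights \<open>c a : a b : b c\<close> in the squared sides.\<close>

lemma brocard_half_iff:
  assumes D: "cross A B C \<noteq> 0"
  shows "brocard_half A B C P w \<longleftrightarrow> P = brocard_center A B C \<and> w = acot (brocard_cot A B C)"
proof -
  define a b c where "a = (dist B C)\<^sup>2" and "b = (dist C A)\<^sup>2" and "c = (dist A B)\<^sup>2"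
  have pos: "a > 0" "b > 0" "c > 0"
    using cross_neq_0_imp_dist[OF D] by (simp_all add: a_def b_def c_def)
  define N where "N = c * a + a * b + b * c"
  have N: "N > 0" using pos by (simp add: N_def add_pos_pos)
  have hull: "interior (convex hull {A, B, C}) =
      {v. \<exists>x y z. 0 < x \<and> 0 < y \<and> 0 < z \<and> x + y + z = 1 \<and> x *\<^sub>R A + y *\<^sub>R B + z *\<^sub>R C = v}"
    using D by (intro interior_convex_hull_3_minimal) (simp_all add: collinear_iff_cross)
  have sys: "angle P A B = acot k \<and> angle P B C = acot k \<and> angle P C A = acot k \<longleftrightarrow>
      k * \<bar>cross A B C\<bar> = (a + b + c) / 2 \<and> y * c = z * a \<and> z * a = x * b"
    if x: "0 < x" "0 < y" "0 < z" "x + y + z = 1" "P = x *\<^sub>R A + y *\<^sub>R B + z *\<^sub>R C" for x y z k P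
  proof -
    have 1: "angle P A B = acot k \<longleftrightarrow>
        y * c + z * (b + c - a) / 2 = (k * \<bar>cross A B C\<bar>) * z"
      unfolding a_def b_def c_def using x D by (intro barycentric_angle) auto
    have 2: "angle P B C = acot k \<longleftrightarrow>
        z * a + x * (c + a - b) / 2 = (k * \<bar>cross A B C\<bar>) * x"
      using barycentric_angle[of B C A y z x P k] x D
      by (simp add: cross_rotate a_def b_def c_def add.commute add.left_commute)
    have 3: "angle P C A = acot k \<longleftrightarrow>
        x * b + y * (a + b - c) / 2 = (k * \<bar>cross A B C\<bar>) * y"
      using barycentric_angle[of C A B z x y P k] x D
      by (simp add: cross_rotate a_def b_def c_def add.commute add.left_commute)
    show ?thesis unfolding 1 2 3 using x(4) by (rule barycentric_system_iff)
  qed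
  have K: "k * \<bar>cross A B C\<bar> = (a + b + c) / 2 \<longleftrightarrow> k = brocard_cot A B C" for k
    unfolding brocard_cot_def a_def[symmetric] b_def[symmetric] c_def[symmetric] using D
    by (auto simp: field_simps)
  have O: "brocard_center A B C = (c * a / N) *\<^sub>R A + (a * b / N) *\<^sub>R B + (b * c / N) *\<^sub>R C"
    unfolding brocard_center_def a_def[symmetric] b_def[symmetric] c_def[symmetric]
      N_def[symmetric] by (simp add: scaleR_add_right divide_inverse mult_ac)
  have p: "0 < c * a / N" "0 < a * b / N" "0 < b * c / N" "c * a / N + a * b / N + b * c / N = 1"
    using pos N by (simp_all add: N_def add_divide_distrib[symmetric])
  show ?thesis
  proof
    assume h: "brocard_half A B C P w"
    then obtain x y z where x: "0 < x" "0 < y" "0 < z" "x + y + z = 1"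
      and P: "P = x *\<^sub>R A + y *\<^sub>R B + z *\<^sub>R C"
      unfolding brocard_half_def hull by blast
    have w: "angle P A B = w" "angle P B C = w" "angle P C A = w"
      using h by (simp_all add: brocard_half_def)
    have "cross A B P = z * cross A B C" using x P by (intro barycentric_cross)
    then have "cross A B P \<noteq> 0" using D x by simp
    then obtain k where k: "w = acot k" using angle_eq_acot w(1) by metis
    have R: "k * \<bar>cross A B C\<bar> = (a + b + c) / 2" "y * c = z * a" "z * a = x * b"
      using sys[OF x P, of k] w k by auto
    \<comment> \<open>The common value of \<open>y c\<close>, \<open>z a\<close> and
      \<open>x b\<close> fixes the ratios; the condition that the coordinates add up to 1 fixes the
      scale.\<close>
    have "x * N = c * a" "y * N = a * b" "z * N = b * c"
      using R(2,3) x(4) unfolding N_def by algebra+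
    then have "x = c * a / N" "y = a * b / N" "z = b * c / N"
      using N by (simp_all add: field_simps)
    then show "P = brocard_center A B C \<and> w = acot (brocard_cot A B C)"
      using R(1) K k P O by simp
  next
    assume h: "P = brocard_center A B C \<and> w = acot (brocard_cot A B C)"
    have "brocard_cot A B C * \<bar>cross A B C\<bar> = (a + b + c) / 2" using K by blast
    then have "angle P A B = w \<and> angle P B C = w \<and> angle P C A = w"
      using sys[OF p, of P "brocard_cot A B C"] h O by simp
    moreover have "P \<in> interior (convex hull {A, B, C})"
      unfolding hull mem_Collect_eq
      by (rule exI[of _ "c * a / N"], rule exI[of _ "a * b / N"], rule exI[of _ "b * c / N"])
        (use h O p in simp)
    ultimately show "brocard_half A B C P w" by (simp add: brocard_half_def)
  qed
qed

lemma brocard_cot_swap: "brocard_cot B A C = brocard_cot A B C"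
  by (simp add: brocard_cot_def cross_swap[of A B C] dist_commute add_ac)

lemma brocard_iff:
  assumes "cross A B C \<noteq> 0"
  shows "brocard (A, B, C) P Q w \<longleftrightarrow>
    P = brocard_center A B C \<and> Q = brocard_center B A C \<and> w = acot (brocard_cot A B C)"
proof -
  have "cross B A C \<noteq> 0" using assms by (simp add: cross_swap[of A B C])
  then show ?thesis
    unfolding brocard_iff_half brocard_half_iff[OF assms]
    by (auto simp: brocard_half_iff brocard_cot_swap[of A B C])
qed

lemma brocard_data:
  assumes "cross A B C \<noteq> 0"
  shows "brocard_point1 (A, B, C) = brocard_center A B C"
    and "brocard_point2 (A, B, C) = brocard_center B A C"
    and "brocard_angle (A, B, C) = acot (brocard_cot A B C)"
  by (simp_all add: brocard_point1_def brocard_point2_def brocard_angle_def brocard_iff[OF assms])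

section \<open>Circumcircle, Brocard circle and Brocard inellipse\<close>

text \<open>Subtracting squared distances shows that \<open>X - Y\<close> is orthogonal to both
  \<open>B - A\<close> and \<open>C - A\<close>, which are independent. This gives uniqueness of the
  circumcenter and also of the Brocard circle.\<close>

lemma equidistant_unique:
  assumes D: "cross A B C \<noteq> 0"
    and X: "dist X A = dist X B" "dist X B = dist X C"
    and Y: "dist Y A = dist Y B" "dist Y B = dist Y C"
  shows "X = Y"
proof -
  have "(dist X A)\<^sup>2 = (dist X B)\<^sup>2" "(dist X B)\<^sup>2 = (dist X C)\<^sup>2"
    "(dist Y A)\<^sup>2 = (dist Y B)\<^sup>2" "(dist Y B)\<^sup>2 = (dist Y C)\<^sup>2"
    using X Y by simp_all
  note * = this[unfolded dist_sq_complex]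
  define p q where "p = Re X - Re Y" and "q = Im X - Im Y"
  have 1: "p * (Re B - Re A) + q * (Im B - Im A) = 0"
    unfolding p_def q_def using *(1,3) by algebra
  have 2: "p * (Re C - Re A) + q * (Im C - Im A) = 0"
    unfolding p_def q_def using * by algebra
  have "p * cross A B C = 0" "q * cross A B C = 0"
    unfolding cross_def minus_complex.simps using 1 2 by algebra+
  then show ?thesis using D by (simp add: p_def q_def complex_eq_iff)
qed

lemma circumcenter_eqI:
  assumes "cross A B C \<noteq> 0" "A \<in> sphere X r" "B \<in> sphere X r" "C \<in> sphere X r"
  shows "circumcenter (A, B, C) = X"
  unfolding circumcenter_def prod.case
proof (rule the_equality)
  show "dist X A = dist X B \<and> dist X B = dist X C" using assms by simp
  then show "Y = X" if "dist Y A = dist Y B \<and> dist Y B = dist Y C" for Y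
    using that assms(1) equidistant_unique by blast
qed

lemma circumcircle_eqI:
  assumes "cross A B C \<noteq> 0" "A \<in> sphere X r" "B \<in> sphere X r" "C \<in> sphere X r"
  shows "circumcircle (A, B, C) = sphere X r"
  unfolding circumcircle_def prod.case circumcenter_eqI[OF assms] using assms by simp

lemma brocard_circle_eqI:
  assumes "cross (circumcenter T) (brocard_point1 T) (brocard_point2 T) \<noteq> 0" "r > 0"
    "circumcenter T \<in> sphere c r" "brocard_point1 T \<in> sphere c r" "brocard_point2 T \<in> sphere c r"
  shows "brocard_circle T = sphere c r"
  unfolding brocard_circle_def
proof (rule the_equality)
  show "(\<exists>c' r'. r' > 0 \<and> sphere c r = sphere c' r') \<and>
      circumcenter T \<in> sphere c r \<and> brocard_point1 T \<in> sphere c r \<and> brocard_point2 T \<in> sphere c r"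
    using assms(2-5) by blast
next
  fix K assume K: "(\<exists>c r. r > 0 \<and> K = sphere c r) \<and>
      circumcenter T \<in> K \<and> brocard_point1 T \<in> K \<and> brocard_point2 T \<in> K"
  then obtain c' r' where K': "K = sphere c' r'" by blast
  have eq: "dist c (circumcenter T) = r" "dist c (brocard_point1 T) = r"
      "dist c (brocard_point2 T) = r" "dist c' (circumcenter T) = r'"
      "dist c' (brocard_point1 T) = r'" "dist c' (brocard_point2 T) = r'"
    using assms(3-5) K unfolding K' mem_sphere by blast+
  have "c' = c" by (rule equidistant_unique[OF assms(1)]) (simp_all add: eq)
  then show "K = sphere c r" using eq K' by simp
qed

section \<open>Ellipses described by their foci\<close>

lemma focal_ellipse:
  assumes b: "0 < b" "b < a" and f: "f\<^sup>2 = a\<^sup>2 - b\<^sup>2"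
  shows "axis_ellipse (Complex 0 y) a b =
    {P. dist P (Complex f y) + dist P (Complex (- f) y) = 2 * a}"
proof (rule set_eqI)
  fix P :: complex
  define p q where "p = Re P" and "q = Im P - y"
  define d e where "d = dist P (Complex f y)" and "e = dist P (Complex (- f) y)"
  have sq: "d\<^sup>2 = (p - f)\<^sup>2 + q\<^sup>2" "e\<^sup>2 = (p + f)\<^sup>2 + q\<^sup>2"
    unfolding d_def e_def dist_sq_complex p_def q_def by simp_all
  have de: "0 \<le> d" "0 \<le> e" by (simp_all add: d_def e_def)
  have a: "a > 0" using b by simp
  have E: "P \<in> axis_ellipse (Complex 0 y) a b \<longleftrightarrow> b\<^sup>2 * p\<^sup>2 + a\<^sup>2 * q\<^sup>2 = a\<^sup>2 * b\<^sup>2"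
    unfolding axis_ellipse_def p_def q_def using a b by (auto simp: field_simps)
  have "b\<^sup>2 * p\<^sup>2 + a\<^sup>2 * q\<^sup>2 = a\<^sup>2 * b\<^sup>2 \<longleftrightarrow> d + e = 2 * a"
  proof
    assume *: "b\<^sup>2 * p\<^sup>2 + a\<^sup>2 * q\<^sup>2 = a\<^sup>2 * b\<^sup>2"
    have "b\<^sup>2 * p\<^sup>2 \<le> a\<^sup>2 * b\<^sup>2" unfolding *[symmetric] by simp
    then have "p\<^sup>2 \<le> a\<^sup>2" using b by (simp add: mult.commute)
    moreover have "f\<^sup>2 \<le> a\<^sup>2" using f by simp
    ultimately have "\<bar>p\<bar> \<le> a" "\<bar>f\<bar> \<le> a" using a by (simp_all add: abs_le_square_iff[symmetric])
    then have "\<bar>f * p\<bar> \<le> a * a" unfolding abs_mult using a by (intro mult_mono) auto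
    then have nn: "0 \<le> a * a - f * p" "0 \<le> a * a + f * p" by linarith+
    \<comment> \<open>The focal distances of a point on the ellipse are \<open>a - f p / a\<close>
      and \<open>a + f p / a\<close>; the bounds on \<open>p\<close> and \<open>f\<close> select the
      nonnegative square roots.\<close>
    have "(a * d)\<^sup>2 = (a * a - f * p)\<^sup>2" "(a * e)\<^sup>2 = (a * a + f * p)\<^sup>2"
      unfolding power_mult_distrib sq using * f by algebra+
    then have "a * d = a * a - f * p" "a * e = a * a + f * p"
      using nn de a by (simp_all add: power2_eq_iff_nonneg)
    then have "a * (d + e) = a * (2 * a)" by algebra
    then show "d + e = 2 * a" using a by simp
  next
    assume *: "d + e = 2 * a"
    \<comment> \<open>Conversely, the sum of the distances and the difference of their squares give
      each distance separately.\<close>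
    have "2 * a * (e - d) = e\<^sup>2 - d\<^sup>2" unfolding *[symmetric] by algebra
    then have "a * (e - d) = 2 * (f * p)" unfolding sq by algebra
    then have "(a * d) = a * a - f * p" using * by algebra
    then have "a\<^sup>2 * d\<^sup>2 = (a * a - f * p)\<^sup>2" by algebra
    then show "b\<^sup>2 * p\<^sup>2 + a\<^sup>2 * q\<^sup>2 = a\<^sup>2 * b\<^sup>2" unfolding sq using f by algebra
  qed
  then show "P \<in> axis_ellipse (Complex 0 y) a b \<longleftrightarrow>
      P \<in> {P. dist P (Complex f y) + dist P (Complex (- f) y) = 2 * a}"
    unfolding E d_def e_def by simp
qed

text \<open>A line touching the smaller of two confocal ellipses passes through the interior of the larger
  one, so it crosses that one on both sides of the point of contact.\<close>

lemma tangent_confocal_not_less: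
  assumes t1: "tangent_side A B {P. dist P F + dist P G = s1}"
    and t2: "tangent_side A B {P. dist P F + dist P G = s2}"
  shows "\<not> s1 < s2"
proof
  assume less: "s1 < s2"
  obtain P where P: "affine hull {A, B} \<inter> {P. dist P F + dist P G = s1} = {P}"
    using t1 unfolding tangent_side_def by blast
  obtain Q where Q: "affine hull {A, B} \<inter> {P. dist P F + dist P G = s2} = {Q}"
    using t2 unfolding tangent_side_def by blast
  have Ps: "P \<in> affine hull {A, B}" "dist P F + dist P G = s1" using P by blast+
  have Qs: "Q \<in> affine hull {A, B}" "dist Q F + dist Q G = s2" using Q by blast+
  have "A \<noteq> B" using Ps Qs less by auto
  obtain u where u: "P = A + u *\<^sub>R (B - A)" using Ps(1) unfolding affine_hull_2_alt by blast
  define h where "h l = dist (P + l *\<^sub>R (B - A)) F + dist (P + l *\<^sub>R (B - A)) G" for l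
  have cont: "continuous_on S h" for S unfolding h_def by (intro continuous_intros)
  have h0: "h 0 = s1" using Ps by (simp add: h_def)
  \<comment> \<open>So far from \<open>P\<close> along the line, the distance to \<open>F\<close>
    alone is at least \<open>s2\<close>, by the triangle inequality.\<close>
  define L where "L = (\<bar>s2\<bar> + norm (P - F)) / norm (B - A)"
  have nz: "norm (B - A) > 0" using \<open>A \<noteq> B\<close> by simp
  have L: "L \<ge> 0" by (simp add: L_def)
  have big: "s2 \<le> h l" if "\<bar>l\<bar> = L" for l
  proof -
    have "norm (l *\<^sub>R (B - A)) = \<bar>s2\<bar> + norm (P - F)" using that nz by (simp add: L_def)
    moreover have "norm (l *\<^sub>R (B - A)) \<le> norm ((P - F) + l *\<^sub>R (B - A)) + norm (P - F)"
      by (metis add_diff_cancel_left' norm_triangle_ineq4)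
    ultimately have "s2 \<le> norm ((P - F) + l *\<^sub>R (B - A))" by linarith
    also have "(P - F) + l *\<^sub>R (B - A) = P + l *\<^sub>R (B - A) - F" by simp
    finally have "s2 \<le> dist (P + l *\<^sub>R (B - A)) F" unfolding dist_norm .
    then show ?thesis unfolding h_def using zero_le_dist[of "P + l *\<^sub>R (B - A)" G] by linarith
  qed
  obtain l where l: "0 \<le> l" "h l = s2"
    using IVT'[of h 0 s2 L] h0 less big[of L] L cont by fastforce
  obtain m where m: "m \<le> 0" "h m = s2"
    using IVT2'[of h 0 s2 "- L"] h0 less big[of "- L"] L cont by fastforce
  have *: "P + l *\<^sub>R (B - A) = Q" if "h l = s2" for l
  proof -
    have "P + l *\<^sub>R (B - A) = A + (u + l) *\<^sub>R (B - A)" by (simp add: u algebra_simps)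
    then have "P + l *\<^sub>R (B - A) \<in> affine hull {A, B}" unfolding affine_hull_2_alt by blast
    then show ?thesis using that Q unfolding h_def by blast
  qed
  \<comment> \<open>Both crossings must be the unique point of contact \<open>Q\<close>. As
    \<open>l\<close> and \<open>m\<close> lie on opposite sides of 0, both would be 0, where
    \<open>h\<close> is \<open>s1\<close>.\<close>
  have "l *\<^sub>R (B - A) = m *\<^sub>R (B - A)" using *[OF l(2)] *[OF m(2)] by (metis add_left_cancel)
  then have "l = m" using \<open>A \<noteq> B\<close> by simp
  then show False using l m h0 less by simp
qed

lemma brocard_inellipse_eqI:
  assumes "dist (brocard_point1 T) (brocard_point2 T) < s"
    and "E = {P. dist P (brocard_point1 T) + dist P (brocard_point2 T) = s}"
    and "circumscribed T E"
  shows "brocard_inellipse T = E"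
  unfolding brocard_inellipse_def
proof (rule the_equality)
  show "(\<exists>s > dist (brocard_point1 T) (brocard_point2 T).
        E = {P. dist P (brocard_point1 T) + dist P (brocard_point2 T) = s}) \<and> circumscribed T E"
    using assms by blast
next
  fix E' assume "(\<exists>s > dist (brocard_point1 T) (brocard_point2 T).
        E' = {P. dist P (brocard_point1 T) + dist P (brocard_point2 T) = s}) \<and> circumscribed T E'"
  then obtain s' where s': "E' = {P. dist P (brocard_point1 T) + dist P (brocard_point2 T) = s'}"
    and c: "circumscribed T E'" by blast
  obtain A B C where T: "T = (A, B, C)" using prod_cases3 by blast
  have t: "tangent_side A B E" "tangent_side A B E'"
    using assms(3) c by (simp_all add: T circumscribed_def)
  note t' = t(1)[unfolded assms(2)] t(2)[unfolded s']
  have "s = s'"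
    using tangent_confocal_not_less[OF t'(1,2)] tangent_confocal_not_less[OF t'(2,1)] by simp
  then show "E' = E" using s' assms(2) by simp
qed

section \<open>The 3-periodics of a Brocard porism\<close>

text \<open>For points of the unit circle, a vanishing centroid characterizes the equilateral
  triangles; both orientations are included.\<close>

definition unit_equilateral :: "complex \<Rightarrow> complex \<Rightarrow> complex \<Rightarrow> bool" where
  "unit_equilateral x y z \<longleftrightarrow> norm x = 1 \<and> norm y = 1 \<and> norm z = 1 \<and> x + y + z = 0"

text \<open>A projective map that takes the unit circle to the circumcircle and the circle of radius
  \<open>1/2\<close> about the origin to the inellipse.\<close>

definition proj_map :: "real \<Rightarrow> real \<Rightarrow> complex \<Rightarrow> complex" where
  "proj_map u v z =
     Complex (sqrt 3 * v * Im z / (2 * (u + v * Re z))) (- 3 / (2 * (u + v * Re z)))"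

definition outer_circle :: "real \<Rightarrow> real \<Rightarrow> complex set" where
  "outer_circle u v = sphere (Complex 0 (- u / 2)) (v / 2)"

text \<open>The inellipse as a polynomial equation, into which points of a line can be substituted
  directly.\<close>

definition inner_conic :: "real \<Rightarrow> complex set" where
  "inner_conic u = {P. 4 * (Re P)\<^sup>2 + (u\<^sup>2 + 1) * (Im P)\<^sup>2 + 4 * u * Im P + 3 = 0}"

lemma unit_iff: "norm z = 1 \<longleftrightarrow> (Re z)\<^sup>2 + (Im z)\<^sup>2 = 1"
  by (simp add: cmod_def)

text \<open>Splits the condition into one for each side, as tangency needs. For the converse, the
  squared norm of the sum expands to 3 - 3.\<close>

lemma unit_equilateral_iff:
  assumes "norm x = 1" "norm y = 1" "norm z = 1"
  shows "unit_equilateral x y z \<longleftrightarrow> x \<bullet> y = - 1 / 2 \<and> y \<bullet> z = - 1 / 2 \<and> z \<bullet> x = - 1 / 2"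
proof
  assume "unit_equilateral x y z"
  then have z: "Re z = - Re x - Re y" "Im z = - Im x - Im y"
    by (auto simp: unit_equilateral_def complex_eq_iff)
  have u: "(Re x)\<^sup>2 + (Im x)\<^sup>2 = 1" "(Re y)\<^sup>2 + (Im y)\<^sup>2 = 1"
    "(- Re x - Re y)\<^sup>2 + (- Im x - Im y)\<^sup>2 = 1"
    using assms unfolding unit_iff z by simp_all
  then have "Re x * Re y + Im x * Im y = - 1 / 2" by (simp add: power2_eq_square algebra_simps)
  then show "x \<bullet> y = - 1 / 2 \<and> y \<bullet> z = - 1 / 2 \<and> z \<bullet> x = - 1 / 2"
    unfolding inner_complex_def z using u by (simp add: power2_eq_square algebra_simps)
next
  assume *: "x \<bullet> y = - 1 / 2 \<and> y \<bullet> z = - 1 / 2 \<and> z \<bullet> x = - 1 / 2"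
  have "(norm (x + y + z))\<^sup>2 = (norm x)\<^sup>2 + (norm y)\<^sup>2 + (norm z)\<^sup>2
      + 2 * (x \<bullet> y) + 2 * (y \<bullet> z) + 2 * (z \<bullet> x)"
    unfolding cmod_power2 inner_complex_def by (simp add: power2_eq_square algebra_simps)
  also have "\<dots> = 0" using * assms by simp
  finally show "unit_equilateral x y z" using assms by (simp add: unit_equilateral_def)
qed

text \<open>The relation \<open>v^2 = u^2 - 3\<close> eliminates the radius, leaving an equation
  linear in \<open>u\<close>.\<close>

lemma outer_circle_iff:
  assumes "v\<^sup>2 = u\<^sup>2 - 3" "v > 0"
  shows "P \<in> outer_circle u v \<longleftrightarrow> (Re P)\<^sup>2 + (Im P)\<^sup>2 + u * Im P + 3 / 4 = 0"
proof -
  have "P \<in> outer_circle u v \<longleftrightarrow> (dist (Complex 0 (- u / 2)) P)\<^sup>2 = (v / 2)\<^sup>2"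
    unfolding outer_circle_def mem_sphere using assms(2) by (subst power2_eq_iff_nonneg) simp_all
  also have "(dist (Complex 0 (- u / 2)) P)\<^sup>2 =
      ((Re P)\<^sup>2 + (Im P)\<^sup>2 + u * Im P + 3 / 4) + (v / 2)\<^sup>2"
    unfolding dist_sq_complex power_divide assms(1) by (simp add: power2_eq_square field_simps)
  finally show ?thesis by simp
qed

text \<open>From \<open>v < u\<close> and \<open>Re z >= -1\<close>: the line that
  \<open>proj_map u v\<close> sends to infinity misses the unit circle.\<close>

lemma proj_denom_pos:
  fixes u v :: real
  assumes "v\<^sup>2 = u\<^sup>2 - 3" "v > 0" "u > 0" "norm z = 1"
  shows "u + v * Re z > 0"
proof -
  have "v < u" by (rule power2_less_imp_less) (use assms in auto)
  moreover have "v * Re z \<ge> - v"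
    using abs_Re_le_cmod[of z] assms mult_left_mono[of "-1" "Re z" v] by simp
  ultimately show ?thesis by linarith
qed

lemma proj_map_in_outer_circle:
  assumes "v\<^sup>2 = u\<^sup>2 - 3" "v > 0" "u > 0" "norm z = 1"
  shows "proj_map u v z \<in> outer_circle u v"
proof -
  define d where "d = u + v * Re z"
  have d: "d > 0" using proj_denom_pos[OF assms] by (simp add: d_def)
  have s: "(Im z)\<^sup>2 = 1 - (Re z)\<^sup>2" using assms(4) by (simp add: unit_iff)
  have "3 * v\<^sup>2 * (Im z)\<^sup>2 + 9 - 6 * u * d + 3 * d\<^sup>2 = 0"
    unfolding s d_def using assms(1) by algebra
  moreover have "(Re (proj_map u v z))\<^sup>2 + (Im (proj_map u v z))\<^sup>2 + u * Im (proj_map u v z) + 3 / 4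
      = (3 * v\<^sup>2 * (Im z)\<^sup>2 + 9 - 6 * u * d + 3 * d\<^sup>2) / (4 * d\<^sup>2)"
    unfolding proj_map_def d_def[symmetric] using d by (simp add: field_simps power2_eq_square)
  ultimately show ?thesis unfolding outer_circle_iff[OF assms(1,2)] by simp
qed

lemma outer_circle_imp_proj_map:
  assumes "v\<^sup>2 = u\<^sup>2 - 3" "v > 0" "u > 0" "P \<in> outer_circle u v"
  obtains z where "norm z = 1" "P = proj_map u v z"
proof -
  define X Y where "X = Re P" and "Y = Im P"
  have e: "X\<^sup>2 + Y\<^sup>2 + u * Y + 3 / 4 = 0"
    using assms(4) unfolding outer_circle_iff[OF assms(1,2)] X_def Y_def .
  have "u * Y < 0" using e zero_le_power2[of X] zero_le_power2[of Y] by linarith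
  then have Y: "Y < 0" using assms(3) by (simp add: mult_less_0_iff)
  \<comment> \<open>Obtained by solving the second coordinate of \<open>proj_map\<close> for
    \<open>Re z\<close> and then the first for \<open>Im z\<close>; the circle lies below the real
    axis, so division by \<open>Y\<close> is possible.\<close>
  define z where "z = Complex ((- 3 / (2 * Y) - u) / v) (- sqrt 3 * X / (v * Y))"
  have d: "u + v * Re z = - 3 / (2 * Y)" using assms(2) by (simp add: z_def)
  have "(3 / (2 * Y) + u)\<^sup>2 + 3 * X\<^sup>2 / Y\<^sup>2 = v\<^sup>2"
  proof -
    have "(3 + 2 * Y * u)\<^sup>2 + 12 * X\<^sup>2 = 4 * Y\<^sup>2 * v\<^sup>2" using e assms(1) by algebra
    then show ?thesis using Y by (simp add: field_simps power2_eq_square)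
  qed
  moreover have "(Re z)\<^sup>2 + (Im z)\<^sup>2 = ((3 / (2 * Y) + u)\<^sup>2 + 3 * X\<^sup>2 / Y\<^sup>2) / v\<^sup>2"
    using Y assms(2) by (simp add: z_def power_divide power_mult_distrib field_simps power2_eq_square)
  ultimately have "norm z = 1" using assms(2) by (simp add: unit_iff)
  moreover have "P = proj_map u v z"
    unfolding proj_map_def d using Y assms(2)
    by (simp add: complex_eq_iff X_def[symmetric] Y_def[symmetric]) (simp add: z_def)
  ultimately show ?thesis using that by blast
qed

text \<open>The weights \<open>a\<close> and \<open>b\<close> are homogeneous: the point with
  parameter \<open>l\<close> is the image of \<open>(a z + b w) / (a + b)\<close> when
  \<open>a + b\<close> is nonzero. The conic pulls back to
  \<open>|a z + b w|^2 = (a + b)^2 / 4\<close>, the circle of radius 1/2, and four times the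
  difference of the two sides is the quadratic form stated.\<close>

lemma inner_conic_line_iff:
  assumes v: "v\<^sup>2 = u\<^sup>2 - 3" "v > 0" "u > 0" and n: "norm z = 1" "norm w = 1"
    and ab: "a * (u + v * Re z) = 1 - l" "b * (u + v * Re w) = l"
  shows "proj_map u v z + l *\<^sub>R (proj_map u v w - proj_map u v z) \<in> inner_conic u \<longleftrightarrow>
    3 * (a\<^sup>2 + b\<^sup>2) + (8 * (z \<bullet> w) - 2) * (a * b) = 0"
proof -
  define P where "P = proj_map u v z + l *\<^sub>R (proj_map u v w - proj_map u v z)"
  define d e where "d = u + v * Re z" and "e = u + v * Re w"
  have d: "d > 0" "e > 0" unfolding d_def e_def using proj_denom_pos v n by blast+
  then have a: "a = (1 - l) / d" and b: "b = l / e"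
    using ab by (simp_all add: d_def e_def field_simps)
  define p q where "p = a * Re z + b * Re w" and "q = a * Im z + b * Im w"
  have s: "u * (a + b) + v * p = 1" using ab unfolding p_def by (simp add: algebra_simps)
  have P: "Re P = sqrt 3 * v / 2 * q" "Im P = - 3 / 2 * (a + b)"
    unfolding P_def proj_map_def q_def a b d_def[symmetric] e_def[symmetric] using d by (simp_all add: field_simps)
  have sq: "(Re P)\<^sup>2 = 3 / 4 * v\<^sup>2 * q\<^sup>2" unfolding P by (simp add: power_mult_distrib power_divide)
  \<comment> \<open>Homogenizing: each missing factor 1 is written as
    \<open>u * (a + b) + v * p\<close>.\<close>
  have "4 * (Re P)\<^sup>2 + (u\<^sup>2 + 1) * (Im P)\<^sup>2 + 4 * u * Im P + 3
      = 3 * v\<^sup>2 * q\<^sup>2 + 9 / 4 * (u\<^sup>2 + 1) * (a + b)\<^sup>2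
        - 6 * u * (a + b) * (u * (a + b) + v * p) + 3 * (u * (a + b) + v * p)\<^sup>2"
    unfolding sq P(2) s by (simp add: power2_eq_square algebra_simps)
  also have "\<dots> = 3 * v\<^sup>2 * (p\<^sup>2 + q\<^sup>2) - 3 / 4 * (u\<^sup>2 - 3) * (a + b)\<^sup>2"
    by (simp add: power2_eq_square field_simps)
  also have "\<dots> = 3 * v\<^sup>2 * (p\<^sup>2 + q\<^sup>2 - (a + b)\<^sup>2 / 4)"
    unfolding v(1) by (simp add: algebra_simps)
  also have "p\<^sup>2 + q\<^sup>2 = a\<^sup>2 * ((Re z)\<^sup>2 + (Im z)\<^sup>2) + b\<^sup>2 * ((Re w)\<^sup>2 + (Im w)\<^sup>2) + 2 * a * b * (z \<bullet> w)"
    unfolding p_def q_def inner_complex_def by (simp add: power2_eq_square algebra_simps)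
  also have "\<dots> = a\<^sup>2 + b\<^sup>2 + 2 * a * b * (z \<bullet> w)"
    using n unfolding unit_iff by simp
  also have "3 * v\<^sup>2 * (a\<^sup>2 + b\<^sup>2 + 2 * a * b * (z \<bullet> w) - (a + b)\<^sup>2 / 4)
      = 3 / 4 * v\<^sup>2 * (3 * (a\<^sup>2 + b\<^sup>2) + (8 * (z \<bullet> w) - 2) * (a * b))"
    by (simp add: power2_eq_square field_simps)
  finally have F: "4 * (Re P)\<^sup>2 + (u\<^sup>2 + 1) * (Im P)\<^sup>2 + 4 * u * Im P + 3
      = 3 / 4 * v\<^sup>2 * (3 * (a\<^sup>2 + b\<^sup>2) + (8 * (z \<bullet> w) - 2) * (a * b))" .
  show ?thesis
    unfolding P_def[symmetric] inner_conic_def mem_Collect_eq F using v(2) by simp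
qed

text \<open>The quadratic form on the line is symmetric in the two weights, so a unique zero must be
  invariant under exchanging them. On the segment both weights are nonnegative, which leaves only
  \<open>a = b\<close>, and then \<open>z \<bullet> w = - 1 / 2\<close>. For that value the form is
  \<open>3 * (a - b)^2\<close>, with a single zero.\<close>

lemma tangent_side_iff:
  assumes v: "v\<^sup>2 = u\<^sup>2 - 3" "v > 0" "u > 0" and n: "norm z = 1" "norm w = 1"
  shows "tangent_side (proj_map u v z) (proj_map u v w) (inner_conic u) \<longleftrightarrow> z \<bullet> w = - 1 / 2"
proof -
  define d e where "d = u + v * Re z" and "e = u + v * Re w"
  have de: "d > 0" "e > 0" using proj_denom_pos v n unfolding d_def e_def by blast+
  define A B where "A = proj_map u v z" and "B = proj_map u v w"
  have line: "A + l *\<^sub>R (B - A) \<in> inner_conic u \<longleftrightarrow>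
      3 * (a\<^sup>2 + b\<^sup>2) + (8 * (z \<bullet> w) - 2) * (a * b) = 0"
    if "a * d = 1 - l" "b * e = l" for l a b
    unfolding A_def B_def using inner_conic_line_iff[OF v n] that unfolding d_def e_def by blast
  have hull: "affine hull {A, B} = range (\<lambda>l. A + l *\<^sub>R (B - A))" by (rule affine_hull_2_alt)
  have seg: "closed_segment A B = (\<lambda>l. A + l *\<^sub>R (B - A)) ` {0..1}"
    unfolding closed_segment_image_interval by (simp add: algebra_simps)
  have "tangent_side A B (inner_conic u) \<longleftrightarrow> z \<bullet> w = - 1 / 2"
  proof
    assume "tangent_side A B (inner_conic u)"
    then obtain P where P: "P \<in> closed_segment A B" "affine hull {A, B} \<inter> inner_conic u = {P}"
      unfolding tangent_side_def by blast
    then obtain l where l: "0 \<le> l" "l \<le> 1" "P = A + l *\<^sub>R (B - A)" unfolding seg by auto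
    have uniq: "A + m *\<^sub>R (B - A) = P" if "A + m *\<^sub>R (B - A) \<in> inner_conic u" for m
      using P(2) that unfolding hull by blast
    define a b where "a = (1 - l) / d" and "b = l / e"
    have ab: "a * d = 1 - l" "b * e = l" "a \<ge> 0" "b \<ge> 0"
      using de l by (simp_all add: a_def b_def)
    have eq: "3 * (a\<^sup>2 + b\<^sup>2) + (8 * (z \<bullet> w) - 2) * (a * b) = 0"
      using line[OF ab(1,2)] P(2) l(3) by auto
    \<comment> \<open>If the endpoints coincided, \<open>A\<close> would lie on the conic, but the
      form at weights \<open>1 / d\<close> and 0 is positive.\<close>
    have "A \<noteq> B"
    proof
      assume "A = B"
      then have "A + 0 *\<^sub>R (B - A) \<in> inner_conic u" using P l by auto
      then have "3 * ((1 / d)\<^sup>2 + 0\<^sup>2) + (8 * (z \<bullet> w) - 2) * (1 / d * 0) = 0"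
        using line[of "1 / d" 0 0] de by simp
      then show False using de by simp
    qed
    have "a \<noteq> 0" using eq ab de by auto
    moreover have "b \<noteq> 0" using eq ab de by auto
    ultimately have pos: "a > 0" "b > 0" using ab by simp_all
    \<comment> \<open>Rescales the exchanged weights so that they belong to a point of the line
      again, the one with parameter \<open>g * a * e\<close>.\<close>
    define g where "g = 1 / (a * e + b * d)"
    have "a * e + b * d > 0" using pos de by (simp add: add_pos_pos)
    then have g: "g > 0" "g * (a * e + b * d) = 1" by (simp_all add: g_def)
    have "A + (g * a * e) *\<^sub>R (B - A) \<in> inner_conic u \<longleftrightarrow>
        3 * ((g * b)\<^sup>2 + (g * a)\<^sup>2) + (8 * (z \<bullet> w) - 2) * ((g * b) * (g * a)) = 0"
      using g(2) by (intro line) (simp_all add: algebra_simps)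
    also have "\<dots> \<longleftrightarrow> g\<^sup>2 * (3 * (a\<^sup>2 + b\<^sup>2) + (8 * (z \<bullet> w) - 2) * (a * b)) = 0"
      by (simp only: power2_eq_square algebra_simps)
    finally have "A + (g * a * e) *\<^sub>R (B - A) = P" using uniq eq by simp
    then have gl: "g * a * e = l" using l(3) \<open>A \<noteq> B\<close> by simp
    then have "(g * a) * e = b * e" using ab(2) by simp
    then have "g * a = b" using de by simp
    moreover have "g * b * d = 1 - g * a * e" using g(2) by (simp add: algebra_simps)
    then have "(g * b) * d = a * d" using gl ab(1) by linarith
    then have "g * b = a" using de by simp
    ultimately have "g\<^sup>2 = 1" using pos by (metis mult.assoc power2_eq_square mult_cancel_right1 less_irrefl)
    then have "g = 1" using g(1) by (simp add: power2_eq_1_iff)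
    then have "a = b" using \<open>g * a = b\<close> by simp
    then have "a\<^sup>2 * (8 * (z \<bullet> w) + 4) = 0" using eq by (simp add: power2_eq_square algebra_simps)
    then show "z \<bullet> w = - 1 / 2" using pos by simp
  next
    assume k: "z \<bullet> w = - 1 / 2"
    \<comment> \<open>The parameter at which the two weights \<open>(1 - m) / d\<close> and
      \<open>m / e\<close> agree.\<close>
    define m where "m = e / (d + e)"
    have m: "0 \<le> m" "m \<le> 1" using de by (simp_all add: m_def)
    have eq: "3 * (a\<^sup>2 + b\<^sup>2) + (8 * (- 1 / 2) - 2) * (a * b) = 3 * (a - b)\<^sup>2" for a b :: real
      by (simp add: power2_eq_square algebra_simps)
    have iff: "A + l *\<^sub>R (B - A) \<in> inner_conic u \<longleftrightarrow> l = m" for l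
    proof -
      have "A + l *\<^sub>R (B - A) \<in> inner_conic u \<longleftrightarrow>
          3 * (((1 - l) / d)\<^sup>2 + (l / e)\<^sup>2) + (8 * (z \<bullet> w) - 2) * ((1 - l) / d * (l / e)) = 0"
        using de by (intro line) simp_all
      also have "\<dots> \<longleftrightarrow> 3 * ((1 - l) / d - l / e)\<^sup>2 = 0"
        unfolding k eq by simp
      also have "\<dots> \<longleftrightarrow> l = m" using de by (auto simp: m_def field_simps)
      finally show ?thesis .
    qed
    have "affine hull {A, B} \<inter> inner_conic u = {A + m *\<^sub>R (B - A)}"
      unfolding hull using iff by auto
    moreover have "A + m *\<^sub>R (B - A) \<in> closed_segment A B" unfolding seg using m by auto
    ultimately show "tangent_side A B (inner_conic u)" unfolding tangent_side_def by blast
  qed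
  then show ?thesis unfolding A_def B_def .
qed

definition porism_of :: "real \<Rightarrow> real \<Rightarrow> complex set \<times> complex set" where
  "porism_of u v = (outer_circle u v, inner_conic u)"

section \<open>Inscribed equilateral triangles and their images\<close>

lemma unit_inner_minus_half:
  assumes n: "norm z = 1" "norm w = 1" and i: "z \<bullet> w = - 1 / 2"
  obtains e where "e\<^sup>2 = 3 / 4" "Re w = - Re z / 2 - e * Im z" "Im w = - Im z / 2 + e * Re z"
proof
  \<comment> \<open>The sine of the oriented angle from \<open>z\<close> to \<open>w\<close>:
    \<open>w\<close> is \<open>z\<close> turned by 120 degrees, and the sign of \<open>e\<close>
    records the direction, so both orientations are treated together.\<close>
  define e where "e = Re z * Im w - Im z * Re w"
  have r: "(Re z)\<^sup>2 + (Im z)\<^sup>2 = 1" "(Re w)\<^sup>2 + (Im w)\<^sup>2 = 1" "Re z * Re w + Im z * Im w = - 1 / 2"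
    using n i unfolding unit_iff inner_complex_def by simp_all
  then show "e\<^sup>2 = 3 / 4"
  proof -
    have "e\<^sup>2 + (Re z * Re w + Im z * Im w)\<^sup>2 = ((Re z)\<^sup>2 + (Im z)\<^sup>2) * ((Re w)\<^sup>2 + (Im w)\<^sup>2)"
      unfolding e_def by algebra
    then show ?thesis unfolding r by (simp add: power_divide)
  qed
  have "Re w = ((Re z)\<^sup>2 + (Im z)\<^sup>2) * Re w" unfolding r by simp
  also have "\<dots> = (Re z * Re w + Im z * Im w) * Re z - e * Im z" unfolding e_def by algebra
  finally show "Re w = - Re z / 2 - e * Im z" unfolding r by simp
  have "Im w = ((Re z)\<^sup>2 + (Im z)\<^sup>2) * Im w" unfolding r by simp
  also have "\<dots> = (Re z * Re w + Im z * Im w) * Im z + e * Re z" unfolding e_def by algebra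
  finally show "Im w = - Im z / 2 + e * Re z" unfolding r by simp
qed

lemma unit_equilateral_param:
  assumes "unit_equilateral z1 z2 z3"
  obtains e where "e\<^sup>2 = 3 / 4" "(Re z1)\<^sup>2 + (Im z1)\<^sup>2 = 1"
    "Re z2 = - Re z1 / 2 - e * Im z1" "Im z2 = - Im z1 / 2 + e * Re z1"
    "Re z3 = - Re z1 / 2 + e * Im z1" "Im z3 = - Im z1 / 2 - e * Re z1"
proof -
  have n: "norm z1 = 1" "norm z2 = 1" "norm z3 = 1" and "z1 + z2 + z3 = 0"
    using assms by (simp_all add: unit_equilateral_def)
  then have z3: "Re z3 = - Re z1 - Re z2" "Im z3 = - Im z1 - Im z2"
    by (auto simp: complex_eq_iff)
  have "z1 \<bullet> z2 = - 1 / 2" using unit_equilateral_iff[OF n] assms by blast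
  then obtain e where "e\<^sup>2 = 3 / 4" "Re z2 = - Re z1 / 2 - e * Im z1" "Im z2 = - Im z1 / 2 + e * Re z1"
    using unit_inner_minus_half n by metis
  then show ?thesis using that[of e] z3 n(1) by (simp add: unit_iff)
qed

text \<open>In homogeneous coordinates the area is a determinant divided by the product of the last
  coordinates; a projective map multiplies the determinant by a constant, here negative, so
  orientation is reversed.\<close>

lemma cross_proj_map:
  assumes v: "v\<^sup>2 = u\<^sup>2 - 3" "v > 0" "u > 0" and "norm x = 1" "norm y = 1" "norm z = 1"
  shows "cross (proj_map u v x) (proj_map u v y) (proj_map u v z) =
    - (3 * sqrt 3 * v\<^sup>2 / 4) * cross x y z / ((u + v * Re x) * (u + v * Re y) * (u + v * Re z))"
proof -
  define c where "c = sqrt 3 * v / 2"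
  have det: "cross (Complex (c * (p1 / d1)) (- 3 / 2 * (1 / d1))) (Complex (c * (p2 / d2)) (- 3 / 2 * (1 / d2)))
      (Complex (c * (p3 / d3)) (- 3 / 2 * (1 / d3))) =
    - (3 / 2) * c * (p1 * (d3 - d2) + p2 * (d1 - d3) + p3 * (d2 - d1)) / (d1 * d2 * d3)"
    if "d1 > 0" "d2 > 0" "d3 > 0" for p1 p2 p3 d1 d2 d3 :: real
  proof -
    have K: "cross (Complex (c * x1) (- 3 / 2 * i1)) (Complex (c * x2) (- 3 / 2 * i2))
        (Complex (c * x3) (- 3 / 2 * i3)) =
      - (3 / 2) * c * (x1 * (i2 - i3) + x2 * (i3 - i1) + x3 * (i1 - i2))" for x1 x2 x3 i1 i2 i3 :: real
      unfolding cross_def by (simp add: field_simps)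
    have L: "p1 / d1 * (1 / d2 - 1 / d3) = p1 * (d3 - d2) / (d1 * d2 * d3)"
      "p2 / d2 * (1 / d3 - 1 / d1) = p2 * (d1 - d3) / (d1 * d2 * d3)"
      "p3 / d3 * (1 / d1 - 1 / d2) = p3 * (d2 - d1) / (d1 * d2 * d3)"
      using that by (simp_all add: field_simps)
    show ?thesis unfolding K L add_divide_distrib[symmetric] by simp
  qed
  have p: "proj_map u v w = Complex (c * (Im w / (u + v * Re w))) (- 3 / 2 * (1 / (u + v * Re w)))" for w
    by (simp add: proj_map_def c_def)
  have "cross (proj_map u v x) (proj_map u v y) (proj_map u v z) =
      - (3 / 2) * c * (Im x * ((u + v * Re z) - (u + v * Re y)) + Im y * ((u + v * Re x) - (u + v * Re z))
        + Im z * ((u + v * Re y) - (u + v * Re x)))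
      / ((u + v * Re x) * (u + v * Re y) * (u + v * Re z))"
    unfolding p by (rule det) (use proj_denom_pos[OF v] assms in auto)
  also have "- (3 / 2) * c * (Im x * ((u + v * Re z) - (u + v * Re y)) + Im y * ((u + v * Re x) - (u + v * Re z))
        + Im z * ((u + v * Re y) - (u + v * Re x))) = - (3 * sqrt 3 * v\<^sup>2 / 4) * cross x y z"
    by (simp add: c_def cross_def power2_eq_square field_simps)
  finally show ?thesis .
qed

lemma abs_cross_unit_equilateral:
  assumes "unit_equilateral x y z"
  shows "\<bar>cross x y z\<bar> = 3 * sqrt 3 / 2"
proof -
  obtain e where e: "e\<^sup>2 = 3 / 4" "(Re x)\<^sup>2 + (Im x)\<^sup>2 = 1"
    "Re y = - Re x / 2 - e * Im x" "Im y = - Im x / 2 + e * Re x"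
    "Re z = - Re x / 2 + e * Im x" "Im z = - Im x / 2 - e * Re x"
    using unit_equilateral_param[OF assms] by metis
  have "cross x y z = 3 * e * ((Re x)\<^sup>2 + (Im x)\<^sup>2)"
    unfolding cross_def minus_complex.simps e(3-6) by (simp add: power2_eq_square algebra_simps)
  then have "\<bar>cross x y z\<bar>\<^sup>2 = (3 * sqrt 3 / 2)\<^sup>2"
    using e(1,2) by (simp add: power_mult_distrib power_divide)
  then show ?thesis by (subst (asm) power2_eq_iff_nonneg) simp_all
qed

text \<open>Poncelet's porism made explicit: vertices lift to the unit circle, and each tangency
  says that two lifts are 120 degrees apart.\<close>

lemma three_periodics_porism_of:
  assumes v: "v\<^sup>2 = u\<^sup>2 - 3" "v > 0" "u > 0"
  shows "three_periodics (porism_of u v) =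
    {(proj_map u v x, proj_map u v y, proj_map u v z) | x y z. unit_equilateral x y z}"
proof (rule set_eqI)
  fix T :: triangle
  obtain A B C where T: "T = (A, B, C)" using prod_cases3 by blast
  show "T \<in> three_periodics (porism_of u v) \<longleftrightarrow>
      T \<in> {(proj_map u v x, proj_map u v y, proj_map u v z) | x y z. unit_equilateral x y z}"
  proof
    assume "T \<in> three_periodics (porism_of u v)"
    then have ABC: "A \<in> outer_circle u v" "B \<in> outer_circle u v" "C \<in> outer_circle u v"
      and c: "tangent_side A B (inner_conic u)" "tangent_side B C (inner_conic u)"
        "tangent_side C A (inner_conic u)"
      by (auto simp: T three_periodics_def porism_of_def circumscribed_def)
    obtain x where x: "norm x = 1" "A = proj_map u v x"
      using outer_circle_imp_proj_map[OF v ABC(1)] by metis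
    obtain y where y: "norm y = 1" "B = proj_map u v y"
      using outer_circle_imp_proj_map[OF v ABC(2)] by metis
    obtain z where z: "norm z = 1" "C = proj_map u v z"
      using outer_circle_imp_proj_map[OF v ABC(3)] by metis
    have "unit_equilateral x y z"
      using c unfolding x(2) y(2) z(2)
        tangent_side_iff[OF v x(1) y(1)] tangent_side_iff[OF v y(1) z(1)] tangent_side_iff[OF v z(1) x(1)]
      using unit_equilateral_iff[OF x(1) y(1) z(1)] by blast
    then show "T \<in> {(proj_map u v x, proj_map u v y, proj_map u v z) | x y z. unit_equilateral x y z}"
      using T x y z by blast
  next
    assume "T \<in> {(proj_map u v x, proj_map u v y, proj_map u v z) | x y z. unit_equilateral x y z}"
    then obtain x y z where e: "unit_equilateral x y z"
      and T': "T = (proj_map u v x, proj_map u v y, proj_map u v z)" by blast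
    have n: "norm x = 1" "norm y = 1" "norm z = 1" using e by (simp_all add: unit_equilateral_def)
    have d: "u + v * Re x > 0" "u + v * Re y > 0" "u + v * Re z > 0"
      using proj_denom_pos v n by blast+
    have "cross (proj_map u v x) (proj_map u v y) (proj_map u v z) \<noteq> 0"
      unfolding cross_proj_map[OF v n] using abs_cross_unit_equilateral[OF e] v(2) d by auto
    moreover have "x \<bullet> y = - 1 / 2 \<and> y \<bullet> z = - 1 / 2 \<and> z \<bullet> x = - 1 / 2"
      using unit_equilateral_iff[OF n] e by blast
    ultimately show "T \<in> three_periodics (porism_of u v)"
      unfolding T' three_periodics_def porism_of_def circumscribed_def
      using n by (simp add: collinear_iff_cross tangent_side_iff[OF v] proj_map_in_outer_circle[OF v])
  qed
qed

text \<open>For a triangle this makes the squared side proportional to the denominator at the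
  opposite vertex, the product of all three being a common factor.\<close>

lemma dist_sq_proj_map:
  assumes v: "v\<^sup>2 = u\<^sup>2 - 3" "v > 0" "u > 0" and n: "norm z = 1" "norm w = 1"
    and i: "z \<bullet> w = - 1 / 2"
  shows "(dist (proj_map u v z) (proj_map u v w))\<^sup>2 =
    9 * v\<^sup>2 / (4 * ((u + v * Re z) * (u + v * Re w)))"
proof -
  define d e where "d = u + v * Re z" and "e = u + v * Re w"
  have de: "d > 0" "e > 0" using proj_denom_pos v n unfolding d_def e_def by blast+
  have r: "(Im z)\<^sup>2 = 1 - (Re z)\<^sup>2" "(Im w)\<^sup>2 = 1 - (Re w)\<^sup>2" "Im z * Im w = - 1 / 2 - Re z * Re w"
    using n i unfolding unit_iff inner_complex_def by simp_all
  have sq: "sqrt 3 * (sqrt 3 * a) = 3 * a" for a by (simp flip: mult.assoc)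
  have "(dist (proj_map u v z) (proj_map u v w))\<^sup>2 =
      (3 * v\<^sup>2 * (Im z * e - Im w * d)\<^sup>2 + 9 * v\<^sup>2 * (Re z - Re w)\<^sup>2) / (4 * (d * e)\<^sup>2)"
  proof -
    have "Re (proj_map u v z) - Re (proj_map u v w) = sqrt 3 * v * (Im z * e - Im w * d) / (2 * (d * e))"
      unfolding proj_map_def d_def[symmetric] e_def[symmetric] using de by (simp add: field_simps)
    moreover have "Im (proj_map u v z) - Im (proj_map u v w) = 3 * v * (Re z - Re w) / (2 * (d * e))"
      unfolding proj_map_def complex.sel d_def[symmetric] e_def[symmetric]
    proof -
      have "v * (Re z - Re w) = d - e" by (simp add: d_def e_def algebra_simps)
      then have "3 * v * (Re z - Re w) / (2 * (d * e)) = 3 * (d - e) / (2 * (d * e))" by (simp add: mult.assoc)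
      also have "\<dots> = - 3 / (2 * d) - - 3 / (2 * e)" using de by (simp add: field_simps)
      finally show "- 3 / (2 * d) - - 3 / (2 * e) = 3 * v * (Re z - Re w) / (2 * (d * e))" by simp
    qed
    ultimately show ?thesis unfolding dist_sq_complex
      by (simp add: power_divide power_mult_distrib add_divide_distrib)
  qed
  \<comment> \<open>Here \<open>v^2 = u^2 - 3\<close> and the angle of 120 degrees combine; the
    terms in \<open>(Re z - Re w)^2\<close> then cancel.\<close>
  also have "(Im z * e - Im w * d)\<^sup>2 = 3 * (d * e) - 3 * (Re z - Re w)\<^sup>2"
    unfolding d_def e_def using r v(1) by algebra
  also have "(3 * v\<^sup>2 * (3 * (d * e) - 3 * (Re z - Re w)\<^sup>2) + 9 * v\<^sup>2 * (Re z - Re w)\<^sup>2) / (4 * (d * e)\<^sup>2)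
      = 9 * v\<^sup>2 / (4 * (d * e))"
    using de by (simp add: field_simps power2_eq_square)
  finally show ?thesis unfolding d_def e_def .
qed

lemma unit_equilateral_swap: "unit_equilateral x y z \<Longrightarrow> unit_equilateral y x z"
  by (simp add: unit_equilateral_def add_ac)

text \<open>The sums that occur in the barycentric formulas below. Only the third, which is merely
  cyclic, depends on the orientation, through the sign of \<open>cross x y z\<close>.\<close>

lemma unit_equilateral_denoms:
  assumes "unit_equilateral x y z"
  shows "(u + v * Re x) + (u + v * Re y) + (u + v * Re z) = 3 * u"
    and "(u + v * Re x) * (u + v * Re y) + (u + v * Re y) * (u + v * Re z)
      + (u + v * Re z) * (u + v * Re x) = 3 * u\<^sup>2 - 3 / 4 * v\<^sup>2"
    and "Im x * (u + v * Re z) + Im y * (u + v * Re x) + Im z * (u + v * Re y) = v * cross x y z / 2"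
    and "Im x + Im y + Im z = 0"
proof -
  obtain e where e: "e\<^sup>2 = 3 / 4" "(Re x)\<^sup>2 + (Im x)\<^sup>2 = 1"
    "Re y = - Re x / 2 - e * Im x" "Im y = - Im x / 2 + e * Re x"
    "Re z = - Re x / 2 + e * Im x" "Im z = - Im x / 2 - e * Re x"
    using unit_equilateral_param[OF assms] by metis
  show "Im x + Im y + Im z = 0" by (simp add: e)
  show "(u + v * Re x) + (u + v * Re y) + (u + v * Re z) = 3 * u" by (simp add: e algebra_simps)
  have "(u + v * Re x) * (u + v * Re y) + (u + v * Re y) * (u + v * Re z) + (u + v * Re z) * (u + v * Re x)
      = 3 * u\<^sup>2 - v\<^sup>2 * (3 / 4 * (Re x)\<^sup>2 + e\<^sup>2 * (Im x)\<^sup>2)"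
    unfolding e(3,5) by (simp add: power2_eq_square field_simps)
  also have "3 / 4 * (Re x)\<^sup>2 + e\<^sup>2 * (Im x)\<^sup>2 = 3 / 4" using e(1,2) by algebra
  finally show "(u + v * Re x) * (u + v * Re y) + (u + v * Re y) * (u + v * Re z)
      + (u + v * Re z) * (u + v * Re x) = 3 * u\<^sup>2 - 3 / 4 * v\<^sup>2" by simp
  have 1: "Im x * (u + v * Re z) + Im y * (u + v * Re x) + Im z * (u + v * Re y)
      = v * (3 / 2 * e * ((Re x)\<^sup>2 + (Im x)\<^sup>2) + Re x * Im x * (e\<^sup>2 - 3 / 4))"
    unfolding e(3-6) by (simp add: power2_eq_square field_simps)
  have 2: "cross x y z = 3 * e * ((Re x)\<^sup>2 + (Im x)\<^sup>2)"
    unfolding cross_def minus_complex.simps e(3-6) by (simp add: power2_eq_square algebra_simps)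
  show "Im x * (u + v * Re z) + Im y * (u + v * Re x) + Im z * (u + v * Re y) = v * cross x y z / 2"
    unfolding 1 2 e(1,2) by simp
qed

lemma dist_sq_unit_equilateral:
  assumes v: "v\<^sup>2 = u\<^sup>2 - 3" "v > 0" "u > 0" and e: "unit_equilateral x y z"
    and d: "d1 = u + v * Re x" "d2 = u + v * Re y" "d3 = u + v * Re z"
  shows "(dist (proj_map u v y) (proj_map u v z))\<^sup>2 = 9 * v\<^sup>2 / 4 * d1 / (d1 * d2 * d3)"
    "(dist (proj_map u v z) (proj_map u v x))\<^sup>2 = 9 * v\<^sup>2 / 4 * d2 / (d1 * d2 * d3)"
    "(dist (proj_map u v x) (proj_map u v y))\<^sup>2 = 9 * v\<^sup>2 / 4 * d3 / (d1 * d2 * d3)"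
proof -
  have n: "norm x = 1" "norm y = 1" "norm z = 1" using e by (simp_all add: unit_equilateral_def)
  have i: "x \<bullet> y = - 1 / 2" "y \<bullet> z = - 1 / 2" "z \<bullet> x = - 1 / 2"
    using unit_equilateral_iff[OF n] e by blast+
  have "d1 > 0" "d2 > 0" "d3 > 0" unfolding d using proj_denom_pos v n by blast+
  then show "(dist (proj_map u v y) (proj_map u v z))\<^sup>2 = 9 * v\<^sup>2 / 4 * d1 / (d1 * d2 * d3)"
    "(dist (proj_map u v z) (proj_map u v x))\<^sup>2 = 9 * v\<^sup>2 / 4 * d2 / (d1 * d2 * d3)"
    "(dist (proj_map u v x) (proj_map u v y))\<^sup>2 = 9 * v\<^sup>2 / 4 * d3 / (d1 * d2 * d3)"
    using dist_sq_proj_map[OF v n(2,3) i(2)] dist_sq_proj_map[OF v n(3,1) i(3)]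
      dist_sq_proj_map[OF v n(1,2) i(1)]
    unfolding d[symmetric] by simp_all
qed

lemma cross_proj_map_neq_0:
  assumes v: "v\<^sup>2 = u\<^sup>2 - 3" "v > 0" "u > 0" and e: "unit_equilateral x y z"
  shows "cross (proj_map u v x) (proj_map u v y) (proj_map u v z) \<noteq> 0"
proof -
  have n: "norm x = 1" "norm y = 1" "norm z = 1" using e by (simp_all add: unit_equilateral_def)
  have "u + v * Re x > 0" "u + v * Re y > 0" "u + v * Re z > 0"
    using proj_denom_pos v n by blast+
  then show ?thesis
    unfolding cross_proj_map[OF v n] using abs_cross_unit_equilateral[OF e] v(2) by auto
qed

text \<open>The sum of squared sides and the area share the factor \<open>v^2 / M\<close>, so the
  quotient is the same for every triangle of the family.\<close>

lemma brocard_cot_proj_map: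
  assumes v: "v\<^sup>2 = u\<^sup>2 - 3" "v > 0" "u > 0" and e: "unit_equilateral x y z"
  shows "brocard_cot (proj_map u v x) (proj_map u v y) (proj_map u v z) = u"
proof -
  define d1 d2 d3 where d: "d1 = u + v * Re x" "d2 = u + v * Re y" "d3 = u + v * Re z"
  have n: "norm x = 1" "norm y = 1" "norm z = 1" using e by (simp_all add: unit_equilateral_def)
  have pos: "d1 > 0" "d2 > 0" "d3 > 0" unfolding d using proj_denom_pos v n by blast+
  define M where "M = d1 * d2 * d3"
  have M: "M > 0" using pos by (simp add: M_def)
  have "(dist (proj_map u v y) (proj_map u v z))\<^sup>2 + (dist (proj_map u v z) (proj_map u v x))\<^sup>2
      + (dist (proj_map u v x) (proj_map u v y))\<^sup>2 = 9 * v\<^sup>2 / 4 * (d1 + d2 + d3) / M"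
    unfolding dist_sq_unit_equilateral[OF v e d] M_def[symmetric]
    by (simp add: add_divide_distrib distrib_left)
  also have "d1 + d2 + d3 = 3 * u" unfolding d by (rule unit_equilateral_denoms(1)[OF e])
  finally have 1: "(dist (proj_map u v y) (proj_map u v z))\<^sup>2 + (dist (proj_map u v z) (proj_map u v x))\<^sup>2
      + (dist (proj_map u v x) (proj_map u v y))\<^sup>2 = 27 / 4 * v\<^sup>2 * u / M" by simp
  have "\<bar>cross (proj_map u v x) (proj_map u v y) (proj_map u v z)\<bar> =
      3 * sqrt 3 * v\<^sup>2 / 4 * \<bar>cross x y z\<bar> / M"
    unfolding cross_proj_map[OF v n] d[symmetric] M_def[symmetric] using M by (simp add: abs_mult)
  also have "\<dots> = 27 / 8 * v\<^sup>2 / M" unfolding abs_cross_unit_equilateral[OF e] by simp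
  finally show ?thesis unfolding brocard_cot_def 1 using M v(2) by simp
qed

text \<open>The weight of each vertex is a product of two denominators, one of them its own, which
  cancels the denominator in \<open>proj_map\<close>. What remains depends on the triangle only
  through its orientation.\<close>

lemma brocard_center_proj_map:
  assumes v: "v\<^sup>2 = u\<^sup>2 - 3" "v > 0" "u > 0" and e: "unit_equilateral x y z"
  shows "brocard_center (proj_map u v x) (proj_map u v y) (proj_map u v z) =
    Complex (sqrt 3 * v\<^sup>2 * cross x y z / (9 * (u\<^sup>2 + 1))) (- 2 * u / (u\<^sup>2 + 1))"
proof -
  define d1 d2 d3 where d: "d1 = u + v * Re x" "d2 = u + v * Re y" "d3 = u + v * Re z"
  have n: "norm x = 1" "norm y = 1" "norm z = 1" using e by (simp_all add: unit_equilateral_def)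
  have pos: "d1 > 0" "d2 > 0" "d3 > 0" unfolding d using proj_denom_pos v n by blast+
  define k where "k = (9 * v\<^sup>2 / 4)\<^sup>2 / (d1 * d2 * d3)\<^sup>2"
  have k: "k > 0" using pos v(2) by (simp add: k_def)
  have w: "9 * v\<^sup>2 / 4 * a / (d1 * d2 * d3) * (9 * v\<^sup>2 / 4 * b / (d1 * d2 * d3)) = k * (a * b)" for a b
    by (simp add: k_def power2_eq_square mult_ac)
  define r where "r = u\<^sup>2 + 1"
  have r: "r > 0" by (simp add: r_def add_nonneg_pos)
  have "d3 * d1 + d1 * d2 + d2 * d3 = 9 / 4 * r"
    using unit_equilateral_denoms(2)[OF e, of u v] unfolding d v(1) r_def by (simp add: algebra_simps)
  then have N: "k * (d3 * d1) + k * (d1 * d2) + k * (d2 * d3) = k * (9 / 4 * r)"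
    by (simp add: distrib_left[symmetric])
  have "k * (d3 * d1) * (sqrt 3 * v * Im x / (2 * d1)) + k * (d1 * d2) * (sqrt 3 * v * Im y / (2 * d2))
      + k * (d2 * d3) * (sqrt 3 * v * Im z / (2 * d3))
      = k * (sqrt 3 * v / 2 * (Im x * d3 + Im y * d1 + Im z * d2))"
    using pos by (simp add: field_simps)
  also have "Im x * d3 + Im y * d1 + Im z * d2 = v * cross x y z / 2"
    unfolding d by (rule unit_equilateral_denoms(3)[OF e])
  finally have R: "k * (d3 * d1) * (sqrt 3 * v * Im x / (2 * d1))
      + k * (d1 * d2) * (sqrt 3 * v * Im y / (2 * d2)) + k * (d2 * d3) * (sqrt 3 * v * Im z / (2 * d3))
      = k * (sqrt 3 * v\<^sup>2 * cross x y z / 4)" by (simp add: power2_eq_square)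
  have "k * (d3 * d1) * (- 3 / (2 * d1)) + k * (d1 * d2) * (- 3 / (2 * d2))
      + k * (d2 * d3) * (- 3 / (2 * d3)) = k * (- 3 / 2 * (d1 + d2 + d3))"
    using pos by (simp add: field_simps)
  also have "d1 + d2 + d3 = 3 * u" unfolding d by (rule unit_equilateral_denoms(1)[OF e])
  finally have I: "k * (d3 * d1) * (- 3 / (2 * d1)) + k * (d1 * d2) * (- 3 / (2 * d2))
      + k * (d2 * d3) * (- 3 / (2 * d3)) = k * (- 9 / 2 * u)" by simp
  show ?thesis
    unfolding brocard_center_def dist_sq_unit_equilateral[OF v e d] w N r_def[symmetric]
    unfolding proj_map_def d[symmetric] complex_eq_iff
    by (simp only: scaleR_complex.sel plus_complex.sel complex.sel R I)
       (use r k in \<open>simp add: field_simps\<close>)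
qed

text \<open>Each vertex is weighted by its own denominator, so the denominators cancel and only
  \<open>Im x + Im y + Im z = 0\<close> and their total \<open>3 * u\<close> matter.\<close>

lemma symmedian_point_proj_map:
  assumes v: "v\<^sup>2 = u\<^sup>2 - 3" "v > 0" "u > 0" and e: "unit_equilateral x y z"
  shows "symmedian_point (proj_map u v x, proj_map u v y, proj_map u v z) = Complex 0 (- 3 / (2 * u))"
proof -
  define d1 d2 d3 where d: "d1 = u + v * Re x" "d2 = u + v * Re y" "d3 = u + v * Re z"
  have n: "norm x = 1" "norm y = 1" "norm z = 1" using e by (simp_all add: unit_equilateral_def)
  have pos: "d1 > 0" "d2 > 0" "d3 > 0" unfolding d using proj_denom_pos v n by blast+
  define k where "k = 9 * v\<^sup>2 / 4 / (d1 * d2 * d3)"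
  have k: "k > 0" using pos v(2) by (simp add: k_def)
  have w: "9 * v\<^sup>2 / 4 * a / (d1 * d2 * d3) = k * a" for a
    by (simp add: k_def)
  have s: "d1 + d2 + d3 = 3 * u" unfolding d by (rule unit_equilateral_denoms(1)[OF e])
  have N: "k * d1 + k * d2 + k * d3 = k * (3 * u)" unfolding s[symmetric] by (simp add: algebra_simps)
  have "k * d1 * (sqrt 3 * v * Im x / (2 * d1)) + k * d2 * (sqrt 3 * v * Im y / (2 * d2))
      + k * d3 * (sqrt 3 * v * Im z / (2 * d3)) = k * (sqrt 3 * v / 2 * (Im x + Im y + Im z))"
    using pos by (simp add: field_simps)
  then have R: "k * d1 * (sqrt 3 * v * Im x / (2 * d1)) + k * d2 * (sqrt 3 * v * Im y / (2 * d2))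
      + k * d3 * (sqrt 3 * v * Im z / (2 * d3)) = 0"
    unfolding unit_equilateral_denoms(4)[OF e] by simp
  have I: "k * d1 * (- 3 / (2 * d1)) + k * d2 * (- 3 / (2 * d2)) + k * d3 * (- 3 / (2 * d3)) = k * (- 9 / 2)"
    using pos by simp
  show ?thesis
    unfolding symmedian_point_def prod.case dist_sq_unit_equilateral[OF v e d] w N
    unfolding proj_map_def d[symmetric] complex_eq_iff
    by (simp only: scaleR_complex.sel plus_complex.sel complex.sel R I)
       (use v k in \<open>simp add: field_simps\<close>)
qed

lemma brocard_points_proj_map:
  assumes v: "v\<^sup>2 = u\<^sup>2 - 3" "v > 0" "u > 0" and e: "unit_equilateral x y z"
    and T: "T = (proj_map u v x, proj_map u v y, proj_map u v z)"
    and f: "f = v\<^sup>2 / (2 * (u\<^sup>2 + 1))" and h: "h = - 2 * u / (u\<^sup>2 + 1)"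
  shows "brocard_point1 T = Complex f h \<and> brocard_point2 T = Complex (- f) h \<or>
    brocard_point1 T = Complex (- f) h \<and> brocard_point2 T = Complex f h"
proof -
  have "cross x y z = 3 * sqrt 3 / 2 \<or> cross x y z = - (3 * sqrt 3 / 2)"
    using abs_cross_unit_equilateral[OF e] by linarith
  moreover have "sqrt 3 * a * (3 * sqrt 3 / 2) / (9 * b) = a / (2 * b)" for a b :: real
  proof -
    have *: "sqrt 3 * a * (3 * sqrt 3 / 2) = (sqrt 3 * sqrt 3) * (3 * a / 2)"
      by (simp only: times_divide_eq_right mult_ac)
    show ?thesis unfolding * by simp
  qed
  ultimately show ?thesis
    unfolding T brocard_data[OF cross_proj_map_neq_0[OF v e]] brocard_center_proj_map[OF v e]
      brocard_center_proj_map[OF v unit_equilateral_swap[OF e]] cross_swap[of y x z] f h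
    by (elim disjE) (simp_all only: mult_minus_right minus_divide_left[symmetric] minus_minus simp_thms)
qed

section \<open>The inner conic as Brocard inellipse\<close>

lemma inner_conic_eq_axis_ellipse:
  assumes v: "v\<^sup>2 = u\<^sup>2 - 3" "v > 0"
  shows "inner_conic u =
    axis_ellipse (Complex 0 (- 2 * u / (u\<^sup>2 + 1))) (v / (2 * sqrt (u\<^sup>2 + 1))) (v / (u\<^sup>2 + 1))"
proof (rule set_eqI)
  fix P
  define N where "N = u\<^sup>2 + 1"
  have N: "N > 0" by (simp add: N_def add_nonneg_pos)
  define X Y where "X = Re P" and "Y = Im P"
  have "(Re (P - Complex 0 (- 2 * u / N)) / (v / (2 * sqrt N)))\<^sup>2 = 4 * N * X\<^sup>2 / v\<^sup>2"
    using N v(2) by (simp add: X_def power_divide power_mult_distrib)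
  moreover have "(Im (P - Complex 0 (- 2 * u / N)) / (v / N))\<^sup>2 = (N * Y + 2 * u)\<^sup>2 / v\<^sup>2"
  proof -
    have *: "Im (P - Complex 0 (- 2 * u / N)) / (v / N) = (N * Y + 2 * u) / v"
      using N v(2) by (simp add: Y_def field_simps)
    show ?thesis unfolding * by (rule power_divide)
  qed
  ultimately have "P \<in> axis_ellipse (Complex 0 (- 2 * u / N)) (v / (2 * sqrt N)) (v / N) \<longleftrightarrow>
      4 * N * X\<^sup>2 / v\<^sup>2 + (N * Y + 2 * u)\<^sup>2 / v\<^sup>2 = 1"
    unfolding axis_ellipse_def by simp
  also have "\<dots> \<longleftrightarrow> 4 * N * X\<^sup>2 + (N * Y + 2 * u)\<^sup>2 = v\<^sup>2"
    using v(2) by (auto simp: add_divide_distrib[symmetric])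
  also have "\<dots> \<longleftrightarrow> N * (4 * X\<^sup>2 + N * Y\<^sup>2 + 4 * u * Y + 3) = 0"
    unfolding v(1) N_def by (simp add: power2_eq_square algebra_simps)
  also have "\<dots> \<longleftrightarrow> P \<in> inner_conic u"
    unfolding inner_conic_def using N by (simp add: X_def Y_def N_def)
  finally show "P \<in> inner_conic u \<longleftrightarrow>
      P \<in> axis_ellipse (Complex 0 (- 2 * u / (u\<^sup>2 + 1))) (v / (2 * sqrt (u\<^sup>2 + 1))) (v / (u\<^sup>2 + 1))"
    unfolding N_def by simp
qed

text \<open>With \<open>N = u^2 + 1 = v^2 + 4\<close> the squared semi-axes differ by
  \<open>v^2 * (N - 4) / (4 * N^2)\<close>, which is exactly \<open>f^2\<close>;
  \<open>N > 4\<close> makes the horizontal axis the major one. The points \<open>f\<close>,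
  \<open>h\<close> are those found for the Brocard points.\<close>

lemma inner_conic_focal:
  assumes v: "v\<^sup>2 = u\<^sup>2 - 3" "v > 0" "u > 0"
    and f: "f = v\<^sup>2 / (2 * (u\<^sup>2 + 1))" and h: "h = - 2 * u / (u\<^sup>2 + 1)"
  shows "inner_conic u =
    {P. dist P (Complex f h) + dist P (Complex (- f) h) = v / sqrt (u\<^sup>2 + 1)}"
    and "2 * f < v / sqrt (u\<^sup>2 + 1)"
proof -
  define N where "N = u\<^sup>2 + 1"
  have N: "N > 4" using v(1) zero_less_power2[of v] v(2) by (simp add: N_def)
  have sN: "sqrt N > 2" using real_sqrt_less_mono[OF N] by simp
  have "2 * sqrt N < sqrt N * sqrt N" using sN N by (intro mult_strict_right_mono) simp_all
  then have "2 * sqrt N < N" using N by simp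
  then have b: "0 < v / N" "v / N < v / (2 * sqrt N)"
    using v(2) N by (simp_all add: divide_strict_left_mono)
  have "f\<^sup>2 = (v / (2 * sqrt N))\<^sup>2 - (v / N)\<^sup>2"
  proof -
    have "(v / (2 * sqrt N))\<^sup>2 - (v / N)\<^sup>2 = v\<^sup>2 * (N - 4) / (4 * N\<^sup>2)"
      using N by (simp add: power_divide power_mult_distrib field_simps power2_eq_square)
    also have "N - 4 = v\<^sup>2" unfolding N_def v(1) by simp
    finally show ?thesis unfolding f N_def[symmetric]
      by (simp add: power_divide power_mult_distrib power2_eq_square)
  qed
  then have "axis_ellipse (Complex 0 h) (v / (2 * sqrt N)) (v / N) =
      {P. dist P (Complex f h) + dist P (Complex (- f) h) = 2 * (v / (2 * sqrt N))}"
    by (rule focal_ellipse[OF b])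
  then show "inner_conic u =
    {P. dist P (Complex f h) + dist P (Complex (- f) h) = v / sqrt (u\<^sup>2 + 1)}"
    unfolding inner_conic_eq_axis_ellipse[OF v(1,2)] h N_def by simp
  have "v < sqrt N" by (rule real_less_rsqrt) (simp add: N_def v(1))
  then have "v * v < v * sqrt N" using v(2) by simp
  then have "v * v / N < v * sqrt N / N" using N by (intro divide_strict_right_mono) simp_all
  also have "v * sqrt N / N = v / sqrt N" using N by (simp add: real_div_sqrt field_simps)
  also have "v * v / N = 2 * f" unfolding f N_def[symmetric] power2_eq_square[of v] by simp
  finally show "2 * f < v / sqrt (u\<^sup>2 + 1)" unfolding N_def .
qed

lemma brocard_inellipse_proj_map:
  assumes v: "v\<^sup>2 = u\<^sup>2 - 3" "v > 0" "u > 0" and e: "unit_equilateral x y z"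
    and T: "T = (proj_map u v x, proj_map u v y, proj_map u v z)"
  shows "brocard_inellipse T = inner_conic u"
proof -
  define f h where f: "f = v\<^sup>2 / (2 * (u\<^sup>2 + 1))" and h: "h = - 2 * u / (u\<^sup>2 + 1)"
  have "T \<in> three_periodics (porism_of u v)"
    unfolding three_periodics_porism_of[OF v] T using e by blast
  then have c: "circumscribed T (inner_conic u)"
    by (auto simp: three_periodics_def porism_of_def)
  note p = brocard_points_proj_map[OF v e T f h]
  have "f \<ge> 0" by (simp add: f)
  then have "dist (Complex f h) (Complex (- f) h) = 2 * f"
    by (simp add: dist_norm cmod_def real_sqrt_mult)
  then have "dist (brocard_point1 T) (brocard_point2 T) < v / sqrt (u\<^sup>2 + 1)"
    using p inner_conic_focal(2)[OF v f h] by (auto simp: dist_commute)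
  moreover have "inner_conic u =
      {P. dist P (brocard_point1 T) + dist P (brocard_point2 T) = v / sqrt (u\<^sup>2 + 1)}"
    using p unfolding inner_conic_focal(1)[OF v f h] by (elim disjE) (simp_all add: add.commute)
  ultimately show ?thesis by (rule brocard_inellipse_eqI[OF _ _ c])
qed

lemma circumcircle_proj_map:
  assumes v: "v\<^sup>2 = u\<^sup>2 - 3" "v > 0" "u > 0" and e: "unit_equilateral x y z"
    and T: "T = (proj_map u v x, proj_map u v y, proj_map u v z)"
  shows "circumcircle T = outer_circle u v" and "circumcenter T = Complex 0 (- u / 2)"
proof -
  have n: "norm x = 1" "norm y = 1" "norm z = 1" using e by (simp_all add: unit_equilateral_def)
  note c = cross_proj_map_neq_0[OF v e] n[THEN proj_map_in_outer_circle[OF v], unfolded outer_circle_def]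
  show "circumcircle T = outer_circle u v" "circumcenter T = Complex 0 (- u / 2)"
    unfolding T outer_circle_def using circumcircle_eqI[OF c] circumcenter_eqI[OF c] by simp_all
qed

lemma brocard_porism_porism_of:
  assumes v: "v\<^sup>2 = u\<^sup>2 - 3" "v > 0" "u > 0"
  shows "brocard_porism (porism_of u v)"
proof -
  \<comment> \<open>A primitive cube root of unity; one inscribed equilateral triangle suffices as a
    witness.\<close>
  define y where "y = Complex (- 1 / 2) (sqrt 3 / 2)"
  have e: "unit_equilateral 1 y (cnj y)"
    by (simp add: unit_equilateral_def y_def cmod_def complex_eq_iff power_divide)
  show ?thesis
    unfolding brocard_porism_def porism_of_def prod.case
    using circumcircle_proj_map(1)[OF v e refl] brocard_inellipse_proj_map[OF v e refl]
      cross_proj_map_neq_0[OF v e] by (metis collinear_iff_cross)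
qed

section \<open>The second Brocard triangle\<close>

text \<open>The identity \<open>(u^2 + 3)^2 - 12 * u^2 = (u^2 - 3)^2\<close> shows that the new pair
  satisfies the same relation; \<open>u' < u\<close> amounts to \<open>u^2 > 3\<close>.\<close>

lemma next_parameter:
  fixes u v :: real
  assumes v: "v\<^sup>2 = u\<^sup>2 - 3" "v > 0" "u > 0"
    and u': "u' = (u\<^sup>2 + 3) / (2 * u)" and v': "v' = v\<^sup>2 / (2 * u)"
  shows "v'\<^sup>2 = u'\<^sup>2 - 3" "v' > 0" "u' > 0" "u' < u"
proof -
  have 0: "u \<noteq> 0" using v by simp
  have "(v\<^sup>2)\<^sup>2 = (u\<^sup>2 + 3)\<^sup>2 - 3 * (2 * u)\<^sup>2" unfolding v(1) by algebra
  then show "v'\<^sup>2 = u'\<^sup>2 - 3"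
    unfolding u' v' power_divide using 0 by (simp add: field_simps)
  show "v' > 0" unfolding v' using v(2,3) by simp
  show "u' > 0" unfolding u' using v(3) by (simp add: add_nonneg_pos)
  have "u\<^sup>2 > 3" using v(1) zero_less_power2[of v] v(2) by simp
  then have "u\<^sup>2 + 3 < u * (2 * u)" by (simp add: power2_eq_square)
  then show "u' < u" unfolding u' using v(3) by (simp add: pos_divide_less_eq)
qed

lemma brocard_circle_proj_map:
  assumes v: "v\<^sup>2 = u\<^sup>2 - 3" "v > 0" "u > 0" and e: "unit_equilateral x y z"
    and T: "T = (proj_map u v x, proj_map u v y, proj_map u v z)"
    and u': "u' = (u\<^sup>2 + 3) / (2 * u)" and v': "v' = v\<^sup>2 / (2 * u)"
  shows "brocard_circle T = outer_circle u' v'"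
proof -
  note w = next_parameter[OF v u' v']
  define f h where f: "f = v\<^sup>2 / (2 * (u\<^sup>2 + 1))" and h: "h = - 2 * u / (u\<^sup>2 + 1)"
  note p = brocard_points_proj_map[OF v e T f h]
  have u1: "u\<^sup>2 + 1 > 0" by (simp add: add_nonneg_pos)
  have fp: "f > 0" using v(2) u1 by (simp add: f)
  have hu: "h + u / 2 = u * v\<^sup>2 / (2 * (u\<^sup>2 + 1))"
    unfolding h v(1) using u1 by (simp add: field_simps power2_eq_square)
  have hp: "h + u / 2 > 0" unfolding hu using v(2,3) u1 by simp
  have "cross (Complex 0 (- u / 2)) (Complex f h) (Complex (- f) h) = 2 * (f * (h + u / 2))"
    "cross (Complex 0 (- u / 2)) (Complex (- f) h) (Complex f h) = - (2 * (f * (h + u / 2)))"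
    by (simp_all add: cross_def algebra_simps)
  then have c: "cross (circumcenter T) (brocard_point1 T) (brocard_point2 T) \<noteq> 0"
    unfolding circumcircle_proj_map(2)[OF v e T] using p fp hp by auto
  \<comment> \<open>This equation determines \<open>u'\<close>: it puts the circumcenter on the new
    outer circle.\<close>
  have "(- u / 2)\<^sup>2 + u' * (- u / 2) + 3 / 4 = 0"
    unfolding u' using v(3) by (simp add: field_simps power2_eq_square)
  then have 1: "circumcenter T \<in> outer_circle u' v'"
    unfolding circumcircle_proj_map(2)[OF v e T] outer_circle_iff[OF w(1,2)] by simp
  have eq: "f\<^sup>2 + h\<^sup>2 + u' * h + 3 / 4 = 0"
  proof -
    define r where "r = u\<^sup>2 + 1"
    have r: "r > 0" using u1 by (simp add: r_def)
    have sq: "f\<^sup>2 = (v\<^sup>2)\<^sup>2 / (4 * r\<^sup>2)" "h\<^sup>2 = 4 * u\<^sup>2 / r\<^sup>2" "u' * h = - ((u\<^sup>2 + 3) / r)"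
      unfolding f h u' r_def[symmetric] using r v(3)
      by (simp_all add: power_divide power_mult_distrib)
    have "4 * r\<^sup>2 * (f\<^sup>2 + h\<^sup>2 + u' * h + 3 / 4) =
        (v\<^sup>2)\<^sup>2 + 16 * u\<^sup>2 - 4 * (u\<^sup>2 + 3) * r + 3 * r\<^sup>2"
      unfolding sq using r by (simp add: field_simps power2_eq_square[of r])
    also have "\<dots> = 0" unfolding v(1) r_def by algebra
    finally show ?thesis using r by simp
  qed
  then have 2: "brocard_point1 T \<in> outer_circle u' v'" "brocard_point2 T \<in> outer_circle u' v'"
    unfolding outer_circle_iff[OF w(1,2)] using p by auto
  show ?thesis
    using 1 2 w(2) unfolding outer_circle_def by (intro brocard_circle_eqI[OF c]) simp_all
qed

text \<open>On the line through the symmedian point the circle equation is a quadratic in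
  \<open>m\<close> with the known root 0, so the other root \<open>l\<close> is rational, and the
  point there is recognized as the image of \<open>-z^2\<close>.\<close>

lemma second_brocard_vertex_proj_map:
  assumes v: "v\<^sup>2 = u\<^sup>2 - 3" "v > 0" "u > 0" and n: "norm z = 1"
    and u': "u' = (u\<^sup>2 + 3) / (2 * u)" and v': "v' = v\<^sup>2 / (2 * u)"
    and K: "brocard_circle T = outer_circle u' v'"
    and S: "symmedian_point T = Complex 0 (- 3 / (2 * u))"
  shows "second_brocard_vertex T (proj_map u v z) = proj_map u' v' (- (z\<^sup>2))"
proof -
  note w = next_parameter[OF v u' v']
  define c s where "c = Re z" and "s = Im z"
  have cs: "c\<^sup>2 + s\<^sup>2 = 1" using n by (simp add: unit_iff c_def s_def)
  define d where "d = u + v * c"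
  have d: "d > 0" using proj_denom_pos[OF v n] by (simp add: d_def c_def)
  \<comment> \<open>The denominator at the antipode \<open>-z\<close>.\<close>
  define d' where "d' = u - v * c"
  have d': "d' > 0" using proj_denom_pos[OF v, of "- z"] n by (simp add: d'_def c_def)
  define X6 where "X6 = Complex 0 (- 3 / (2 * u))"
  define A where "A = proj_map u v z"
  define A' where "A' = proj_map u' v' (- (z\<^sup>2))"
  have AX: "A - X6 = Complex (sqrt 3 * v * s / (2 * d)) (3 * v * c / (2 * u * d))"
  proof -
    have "- 3 / (2 * d) + 3 / (2 * u) = 3 * (d - u) / (2 * u * d)"
      using d v(3) by (simp add: field_simps)
    then show ?thesis
      unfolding A_def X6_def proj_map_def c_def[symmetric] s_def[symmetric] d_def[symmetric]
      by (simp add: complex_eq_iff d_def)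
  qed
  define l where "l = - (v * c) / d'"
  have on: "X6 + m *\<^sub>R (A - X6) \<in> outer_circle u' v' \<longleftrightarrow> m = 0 \<or> m = l" for m
  proof -
    define a b where "a = v * s / d" and "b = v * c / d"
    have ab: "a * d = v * s" "b * d = v * c" using d by (simp_all add: a_def b_def)
    define P where "P = X6 + m *\<^sub>R (A - X6)"
    have P: "Re P = m * (sqrt 3 * a / 2)" "Im P = 3 / (2 * u) * (m * b - 1)"
      unfolding P_def AX unfolding X6_def a_def b_def using v(3) d by (simp_all add: field_simps)
    have sq: "(Re P)\<^sup>2 = 3 / 4 * m\<^sup>2 * a\<^sup>2" unfolding P by (simp add: power_mult_distrib power_divide)
    have "4 * u\<^sup>2 * ((Re P)\<^sup>2 + (Im P)\<^sup>2 + u' * Im P + 3 / 4)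
        = 3 * u\<^sup>2 * m\<^sup>2 * a\<^sup>2 + 9 * (m * b - 1)\<^sup>2 + 3 * (u\<^sup>2 + 3) * (m * b - 1) + 3 * u\<^sup>2"
      unfolding sq P(2) u' using v(3) by (simp add: field_simps power2_eq_square)
    also have "\<dots> = 3 * m * (m * (u\<^sup>2 * a\<^sup>2 + 3 * b\<^sup>2) + v\<^sup>2 * b)"
      unfolding v(1) by algebra
    also have "d * \<dots> = 3 * m * v\<^sup>2 * (m * d' + v * c)"
    proof -
      have "d * (u\<^sup>2 * a\<^sup>2 + 3 * b\<^sup>2) * d = d * d' * v\<^sup>2"
      proof -
        have "d * (u\<^sup>2 * a\<^sup>2 + 3 * b\<^sup>2) * d = v\<^sup>2 * (u\<^sup>2 * s\<^sup>2 + 3 * c\<^sup>2)" using ab by algebra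
        \<comment> \<open>Both sides equal \<open>u^2 - v^2 * c^2\<close>. This removes one factor
          \<open>d\<close> and leaves a linear equation for the nonzero root.\<close>
        also have "u\<^sup>2 * s\<^sup>2 + 3 * c\<^sup>2 = d * d'" unfolding d_def d'_def using cs v(1) by algebra
        finally show ?thesis by (simp only: mult_ac)
      qed
      then have "d * (d * (u\<^sup>2 * a\<^sup>2 + 3 * b\<^sup>2)) = d * (d' * v\<^sup>2)" by (simp only: mult_ac)
      then have "d * (u\<^sup>2 * a\<^sup>2 + 3 * b\<^sup>2) = d' * v\<^sup>2" using d by simp
      then show ?thesis using ab(2) by algebra
    qed
    finally have "d * (4 * u\<^sup>2 * ((Re P)\<^sup>2 + (Im P)\<^sup>2 + u' * Im P + 3 / 4)) =
        3 * m * v\<^sup>2 * (m * d' + v * c)" .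
    then have "(Re P)\<^sup>2 + (Im P)\<^sup>2 + u' * Im P + 3 / 4 = 0 \<longleftrightarrow> m = 0 \<or> m * d' + v * c = 0"
      using d v(2,3) by (metis mult_eq_0_iff less_irrefl power_eq_0_iff zero_neq_numeral)
    also have "m * d' + v * c = 0 \<longleftrightarrow> m = l" using d' by (auto simp: l_def field_simps)
    finally show ?thesis unfolding outer_circle_iff[OF w(1,2)] P_def .
  qed
  have A': "X6 + l *\<^sub>R (A - X6) = A'"
  proof -
    \<comment> \<open>The denominator of the new map at \<open>-z^2\<close> is, up to the factor
      \<open>u\<close>, the product of the old ones at \<open>z\<close> and
      \<open>-z\<close>.\<close>
    have den: "u' + v' * Re (- (z\<^sup>2)) = d * d' / u"
    proof -
      have "Re (- (z\<^sup>2)) = 1 - 2 * c\<^sup>2" using cs by (simp add: power2_eq_square c_def s_def)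
      moreover have "u\<^sup>2 + 3 + v\<^sup>2 * (1 - 2 * c\<^sup>2) = 2 * (d * d')"
        unfolding d_def d'_def using v(1) by algebra
      ultimately show ?thesis unfolding u' v' using v(3) by (simp add: field_simps)
    qed
    have im: "Im (- (z\<^sup>2)) = - 2 * c * s" by (simp add: power2_eq_square c_def s_def)
    have dd: "d * d' = u\<^sup>2 - (v * c)\<^sup>2" unfolding d_def d'_def by algebra
    show ?thesis
      unfolding AX A'_def proj_map_def den im complex_eq_iff
    proof
      show "Re (X6 + l *\<^sub>R Complex (sqrt 3 * v * s / (2 * d)) (3 * v * c / (2 * u * d))) =
          Re (Complex (sqrt 3 * v' * (- 2 * c * s) / (2 * (d * d' / u))) (- 3 / (2 * (d * d' / u))))"
        unfolding X6_def l_def v' using d d' v(3) by (simp add: field_simps power2_eq_square)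
      have "Im (X6 + l *\<^sub>R Complex (sqrt 3 * v * s / (2 * d)) (3 * v * c / (2 * u * d))) =
          - 3 * (d * d' + (v * c)\<^sup>2) / (2 * u * (d * d'))"
        unfolding X6_def l_def using d d' v(3) by (simp add: field_simps power2_eq_square)
      also have "\<dots> = - 3 / (2 * (d * d' / u))"
        using d d' v(3) unfolding dd by (simp add: power2_eq_square)
      finally show "Im (X6 + l *\<^sub>R Complex (sqrt 3 * v * s / (2 * d)) (3 * v * c / (2 * u * d))) =
          Im (Complex (sqrt 3 * v' * (- 2 * c * s) / (2 * (d * d' / u))) (- 3 / (2 * (d * d' / u))))"
        by simp
    qed
  qed
  have line: "affine hull {A, X6} = range (\<lambda>m. X6 + m *\<^sub>R (A - X6))"
    by (subst insert_commute) (rule affine_hull_2_alt)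
  have R: "range g \<inter> U = {g 0, g l}" if "\<And>m. g m \<in> U \<longleftrightarrow> m = 0 \<or> m = l"
    for g :: "real \<Rightarrow> complex" and U
    using that by auto
  have "affine hull {A, X6} \<inter> brocard_circle T = {X6 + 0 *\<^sub>R (A - X6), X6 + l *\<^sub>R (A - X6)}"
    unfolding K line using on by (rule R)
  then have I: "affine hull {A, X6} \<inter> brocard_circle T = {X6, A'}" unfolding A' by simp
  \<comment> \<open>If \<open>A' = X6\<close>, the intersection is a singleton and the tangent case
    of the definition returns \<open>X6\<close>, which is \<open>A'\<close> again.\<close>
  have "(THE P. P \<in> {X6, A'} \<and> P \<noteq> X6) = A'" if "A' \<noteq> X6" using that by auto
  then show ?thesis
    unfolding second_brocard_vertex_def Let_def S X6_def[symmetric] A_def[symmetric] I A'_def[symmetric]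
    by auto
qed

lemma second_brocard_triangle_proj_map:
  assumes v: "v\<^sup>2 = u\<^sup>2 - 3" "v > 0" "u > 0" and e: "unit_equilateral x y z"
    and u': "u' = (u\<^sup>2 + 3) / (2 * u)" and v': "v' = v\<^sup>2 / (2 * u)"
  shows "second_brocard_triangle (proj_map u v x, proj_map u v y, proj_map u v z) =
    (proj_map u' v' (- (x\<^sup>2)), proj_map u' v' (- (y\<^sup>2)), proj_map u' v' (- (z\<^sup>2)))"
proof -
  have n: "norm x = 1" "norm y = 1" "norm z = 1" using e by (simp_all add: unit_equilateral_def)
  show ?thesis
    unfolding second_brocard_triangle_def prod.case
    using n[THEN second_brocard_vertex_proj_map[OF v _ u' v'
        brocard_circle_proj_map[OF v e refl u' v'] symmedian_point_proj_map[OF v e]]] by simp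
qed

section \<open>The map \<open>-z^2\<close> on inscribed equilateral triangles\<close>

lemma unit_equilateral_products:
  assumes "unit_equilateral x y z"
  shows "x * y + y * z + z * x = 0"
proof -
  have n: "norm x = 1" "norm y = 1" "norm z = 1" and s: "x + y + z = 0"
    using assms by (simp_all add: unit_equilateral_def)
  have c: "x * cnj x = 1" "y * cnj y = 1" "z * cnj z = 1"
    using n by (simp_all add: complex_norm_square[symmetric])
  \<comment> \<open>Conjugation inverts unit numbers, so the second symmetric function is the third
    times the conjugate of the first.\<close>
  have "x * y + y * z + z * x = x * y * z * cnj (x + y + z)"
    unfolding complex_cnj_add using c by algebra
  then show ?thesis using s by simp
qed

lemma unit_equilateral_neg_square:
  assumes "unit_equilateral x y z"
  shows "unit_equilateral (- (x\<^sup>2)) (- (y\<^sup>2)) (- (z\<^sup>2))"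
proof -
  have "x + y + z = 0" using assms by (simp add: unit_equilateral_def)
  then have "- (x\<^sup>2) + - (y\<^sup>2) + - (z\<^sup>2) = 0" using unit_equilateral_products[OF assms] by algebra
  then show ?thesis using assms by (simp add: unit_equilateral_def norm_power)
qed

lemma unit_equilateral_neg_square_surj:
  assumes e: "unit_equilateral x y z"
  obtains x' y' z' where "unit_equilateral x' y' z'"
    "x = - (x'\<^sup>2)" "y = - (y'\<^sup>2)" "z = - (z'\<^sup>2)"
proof -
  have n: "norm x = 1" "norm y = 1" "norm z = 1" and s: "x + y + z = 0"
    using e by (simp_all add: unit_equilateral_def)
  have x0: "x \<noteq> 0" using n by auto
  define r where "r = csqrt (- x)"
  have r: "r\<^sup>2 = - x" by (simp add: r_def)
  have "(norm r)\<^sup>2 = 1" using arg_cong[OF r, of norm] n by (simp add: norm_power)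
  then have nr: "norm r = 1" using power2_eq_iff_nonneg[of "norm r" 1] by simp
  have q: "z * z = x * y" "y * y = x * z" using s unit_equilateral_products[OF e] by algebra+
  \<comment> \<open>Squaring turns a rotation by 120 degrees into one by 240, so the preimages of
    \<open>y\<close> and \<open>z\<close> use the quotients \<open>z / x\<close> and
    \<open>y / x\<close> in exchanged order.\<close>
  have "unit_equilateral r (r * z / x) (r * y / x)"
  proof -
    have "r + r * z / x + r * y / x = r * (x + y + z) / x" using x0 by (simp add: field_simps)
    then show ?thesis unfolding unit_equilateral_def using n nr s by (simp add: norm_mult norm_divide)
  qed
  moreover have "x = - (r\<^sup>2)" using r by simp
  moreover have "y = - ((r * z / x)\<^sup>2)"
    unfolding power_divide power_mult_distrib r using x0 q by (simp add: power2_eq_square)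
  moreover have "z = - ((r * y / x)\<^sup>2)"
    unfolding power_divide power_mult_distrib r using x0 q by (simp add: power2_eq_square)
  ultimately show ?thesis using that by blast
qed

lemma second_brocard_triangle_image:
  assumes v: "v\<^sup>2 = u\<^sup>2 - 3" "v > 0" "u > 0"
    and u': "u' = (u\<^sup>2 + 3) / (2 * u)" and v': "v' = v\<^sup>2 / (2 * u)"
  shows "second_brocard_triangle ` three_periodics (porism_of u v) = three_periodics (porism_of u' v')"
proof -
  note w = next_parameter[OF v u' v']
  show ?thesis
    unfolding three_periodics_porism_of[OF v] three_periodics_porism_of[OF w(1-3)]
  proof (intro equalityI subsetI)
    fix T assume "T \<in> second_brocard_triangle `
      {(proj_map u v x, proj_map u v y, proj_map u v z) | x y z. unit_equilateral x y z}"
    then obtain x y z where e: "unit_equilateral x y z"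
      and "T = second_brocard_triangle (proj_map u v x, proj_map u v y, proj_map u v z)" by blast
    then show "T \<in> {(proj_map u' v' x, proj_map u' v' y, proj_map u' v' z) | x y z. unit_equilateral x y z}"
      using second_brocard_triangle_proj_map[OF v e u' v'] unit_equilateral_neg_square[OF e] by blast
  next
    fix T assume "T \<in> {(proj_map u' v' x, proj_map u' v' y, proj_map u' v' z) | x y z. unit_equilateral x y z}"
    then obtain x y z where "unit_equilateral x y z"
      and T: "T = (proj_map u' v' x, proj_map u' v' y, proj_map u' v' z)" by blast
    then obtain x' y' z' where e: "unit_equilateral x' y' z'"
      and "x = - (x'\<^sup>2)" "y = - (y'\<^sup>2)" "z = - (z'\<^sup>2)"
      using unit_equilateral_neg_square_surj by metis
    then have "T = second_brocard_triangle (proj_map u v x', proj_map u v y', proj_map u v z')"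
      using second_brocard_triangle_proj_map[OF v e u' v'] T by simp
    then show "T \<in> second_brocard_triangle `
      {(proj_map u v x, proj_map u v y, proj_map u v z) | x y z. unit_equilateral x y z}"
      using e by blast
  qed
qed

lemma brocard_angle_three_periodics:
  assumes v: "v\<^sup>2 = u\<^sup>2 - 3" "v > 0" "u > 0" and "T \<in> three_periodics (porism_of u v)"
  shows "brocard_angle T = acot u"
proof -
  obtain x y z where e: "unit_equilateral x y z"
    and T: "T = (proj_map u v x, proj_map u v y, proj_map u v z)"
    using assms(4) unfolding three_periodics_porism_of[OF v] by blast
  show ?thesis
    unfolding T brocard_data(3)[OF cross_proj_map_neq_0[OF v e]] brocard_cot_proj_map[OF v e] ..
qed

lemma porism_of_neq:
  assumes v: "v\<^sup>2 = u\<^sup>2 - 3" "v > 0" "u > 0" and w: "v'\<^sup>2 = u'\<^sup>2 - 3" "v' > 0" and "u' \<noteq> u"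
  shows "porism_of u' v' \<noteq> porism_of u v"
proof
  assume eq: "porism_of u' v' = porism_of u v"
  \<comment> \<open>The height of the lowest point of the circle. Were it on both circles,
    subtracting the equations would give \<open>(u' - u) * Y = 0\<close>.\<close>
  define Y where "Y = - (u + v) / 2"
  have "4 * (Y\<^sup>2 + u * Y + 3 / 4) = v\<^sup>2 - (u\<^sup>2 - 3)"
    by (simp add: Y_def power2_eq_square field_simps)
  then have 1: "Y\<^sup>2 + u * Y + 3 / 4 = 0" unfolding v(1) by simp
  then have "Complex 0 Y \<in> outer_circle u v" by (simp add: outer_circle_iff[OF v(1,2)])
  then have "Complex 0 Y \<in> outer_circle u' v'" using eq by (simp add: porism_of_def)
  then have "Y\<^sup>2 + u' * Y + 3 / 4 = 0" by (simp add: outer_circle_iff[OF w])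
  then have "(u' - u) * Y = 0" using 1 by algebra
  then show False using v(2,3) \<open>u' \<noteq> u\<close> by (simp add: Y_def)
qed

section \<open>The parameter t\<close>

lemma half_angle:
  fixes t :: real
  assumes t: "0 < t" "t < pi" and u: "u = cot (t / 2)"
  shows "u > 0" and "cos t = (u\<^sup>2 - 1) / (u\<^sup>2 + 1)" and "sin t = 2 * u / (u\<^sup>2 + 1)"
    and "t = 2 * arctan (1 / u)"
proof -
  define s c where "s = sin (t / 2)" and "c = cos (t / 2)"
  have s: "s > 0" unfolding s_def using t by (intro sin_gt_zero) simp_all
  have c: "c > 0" unfolding c_def using t by (intro cos_gt_zero) simp_all
  have sc: "s\<^sup>2 + c\<^sup>2 = 1" by (simp add: s_def c_def)
  have u': "u = c / s" by (simp add: u cot_def s_def c_def)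
  show "u > 0" unfolding u' using s c by simp
  have "u\<^sup>2 + 1 = (s\<^sup>2 + c\<^sup>2) / s\<^sup>2" unfolding u' using s by (simp add: field_simps)
  then have N: "u\<^sup>2 + 1 = 1 / s\<^sup>2" unfolding sc .
  have "cos t = c\<^sup>2 - s\<^sup>2" using cos_double[of "t / 2"] by (simp add: s_def c_def)
  moreover have "u\<^sup>2 - 1 = (c\<^sup>2 - s\<^sup>2) / s\<^sup>2" unfolding u' using s by (simp add: field_simps)
  ultimately show "cos t = (u\<^sup>2 - 1) / (u\<^sup>2 + 1)" unfolding N using s by simp
  have "sin t = 2 * s * c" using sin_double[of "t / 2"] by (simp add: s_def c_def)
  then show "sin t = 2 * u / (u\<^sup>2 + 1)" unfolding N unfolding u' using s by (simp add: power2_eq_square)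
  have "arctan (1 / u) = t / 2"
    by (rule arctan_unique) (use t in \<open>simp_all add: u cot_def tan_def\<close>)
  then show "t = 2 * arctan (1 / u)" by simp
qed

text \<open>Cosine decreases on the range, and \<open>cos t > 1 / 2\<close> becomes
  \<open>u^2 > 3\<close> under the half-angle substitution.\<close>

lemma half_angle_less_iff:
  fixes t :: real
  assumes t: "0 < t" "t < pi" and u: "u = cot (t / 2)"
  shows "t < pi / 3 \<longleftrightarrow> u\<^sup>2 > 3"
proof -
  note h = half_angle[OF t u]
  have "t < pi / 3 \<longleftrightarrow> cos (pi / 3) < cos t"
    using t by (subst cos_mono_less_eq) simp_all
  also have "\<dots> \<longleftrightarrow> u\<^sup>2 + 1 < 2 * (u\<^sup>2 - 1)"
    unfolding h(2) cos_60 using add_nonneg_pos[of "u\<^sup>2" 1] by (simp add: field_simps)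
  finally show ?thesis by auto
qed

text \<open>Everything follows from \<open>1 - cos t = 2 / r\<close> and
  \<open>2 * cos t - 1 = v^2 / r\<close>, under which the square roots simplify.\<close>

lemma porism_B_eq_porism_of:
  assumes v: "v\<^sup>2 = u\<^sup>2 - 3" "v > 0"
    and c: "cos t = (u\<^sup>2 - 1) / (u\<^sup>2 + 1)" and s: "sin t = 2 * u / (u\<^sup>2 + 1)"
  shows "porism_B t = porism_of u v"
proof -
  define r where "r = u\<^sup>2 + 1"
  have r: "r > 0" by (simp add: r_def add_nonneg_pos)
  have c1: "1 - cos t = 2 / r" and c2: "2 * cos t - 1 = v\<^sup>2 / r"
    unfolding c v(1) using r by (simp_all add: r_def field_simps)
  have c3: "cos t - 1 = - 2 / r" using c1 by simp
  have s': "sin t = 2 * u / r" by (simp add: s r_def)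
  have 5: "- sin t = - 2 * u / r" by (simp add: s')
  have 1: "sin t / (2 * (cos t - 1)) = - u / 2" unfolding c3 s' using r by simp
  have 2: "sqrt ((2 * cos t - 1) / (2 * (1 - cos t))) = v / 2"
    unfolding c1 c2 using r v(2) by (simp add: real_sqrt_divide)
  have 3: "sqrt (2 * cos t - 1) / 2 = v / (2 * sqrt r)"
    unfolding c2 using v(2) by (simp add: real_sqrt_divide)
  have 4: "sqrt ((2 * cos t - 1) * (1 - cos t)) / sqrt 2 = v / r"
    unfolding c1 c2 using v(2) r by (simp add: real_sqrt_divide real_sqrt_mult)
  show ?thesis
    unfolding porism_B_def porism_of_def 1 2 3 4 5 outer_circle_def
      inner_conic_eq_axis_ellipse[OF v] r_def[symmetric] ..
qed

text \<open>At \<open>t = 0\<close> the center is undefined and at \<open>t = pi / 3\<close> the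
  circle shrinks to a point, hence the strict bounds. The Brocard angle of the porism is half its
  parameter, so \<open>\<sigma>'\<close> is \<open>cot (t' / 2)\<close>, while the trigonometric
  quotient is \<open>cot t'\<close>; the two differ and are stated separately.\<close>

theorem theorem5:
  fixes t :: real
  assumes "0 < t" and "t < pi / 3"
  shows "brocard_porism (porism_B t) \<and>
    (\<exists>t' \<omega> \<omega>' \<sigma> \<sigma>' :: real.
      t < t' \<and> t' < pi / 3 \<and>
      brocard_porism (porism_B t') \<and> porism_B t' \<noteq> porism_B t \<and>
      second_brocard_triangle ` three_periodics (porism_B t) = three_periodics (porism_B t') \<and>
      (\<forall>T \<in> three_periodics (porism_B t).
         brocard_angle T = \<omega> \<and> brocard_angle (second_brocard_triangle T) = \<omega>') \<and>
      \<sigma> = cot \<omega> \<and> \<sigma>' = cot \<omega>' \<and>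
      cot t' = (4 - 4 * cos t + cos (2 * t)) / (4 * sin t - sin (2 * t)) \<and>
      cot (t' / 2) = \<sigma>' \<and>
      \<sigma>' = (\<sigma>\<^sup>2 + 3) / (2 * \<sigma>))"
proof -
  define u where "u = cot (t / 2)"
  have tp: "t < pi" using assms pi_gt_zero by linarith
  note h = half_angle[OF assms(1) tp u_def]
  have "u\<^sup>2 > 3" using half_angle_less_iff[OF assms(1) tp u_def] assms(2) by blast
  define v where "v = sqrt (u\<^sup>2 - 3)"
  have v: "v\<^sup>2 = u\<^sup>2 - 3" "v > 0" "u > 0" using \<open>u\<^sup>2 > 3\<close> h(1) by (simp_all add: v_def)
  define u' v' where u': "u' = (u\<^sup>2 + 3) / (2 * u)" and v': "v' = v\<^sup>2 / (2 * u)"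
  note w = next_parameter[OF v u' v']
  define t' where "t' = 2 * arctan (1 / u')"
  have t': "0 < t'" "t' < pi"
    using w(3) arctan_ubound[of "1 / u'"] by (simp_all add: t'_def)
  have ct': "u' = cot (t' / 2)"
    using tan_arctan[of "1 / u'"] by (simp add: t'_def cot_altdef)
  note h' = half_angle[OF t' ct']
  have "u'\<^sup>2 > 3" using w(1) zero_less_power2[of v'] w(2) by simp
  then have "t' < pi / 3" using half_angle_less_iff[OF t' ct'] by blast
  have "1 / u < 1 / u'" using w(3,4) by (intro divide_strict_left_mono) simp_all
  then have "t < t'" by (subst h(4)) (simp add: t'_def arctan_less_iff)
  have B: "porism_B t = porism_of u v" "porism_B t' = porism_of u' v'"
    using porism_B_eq_porism_of v w h h' by blast+
  \<comment> \<open>The double-angle formula for the cotangent; both this and the trigonometric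
    quotient are then reduced to the same rational function of \<open>u\<close>.\<close>
  have "cot t' = (u'\<^sup>2 - 1) / (2 * u')"
    unfolding cot_def h'(2,3) using add_nonneg_pos[of "u'\<^sup>2" 1] by simp
  also have "\<dots> = (u ^ 4 + 2 * u\<^sup>2 + 9) / (4 * u * (u\<^sup>2 + 3))"
  proof -
    have "u'\<^sup>2 - 1 = (u ^ 4 + 2 * u\<^sup>2 + 9) / (4 * u\<^sup>2)"
      unfolding u' using v(3) by (simp add: field_simps power2_eq_square power4_eq_xxxx)
    moreover have "2 * u' = (u\<^sup>2 + 3) / u" unfolding u' using v(3) by (simp add: field_simps)
    ultimately show ?thesis using v(3) by (simp add: power2_eq_square)
  qed
  also have "\<dots> = (4 - 4 * cos t + cos (2 * t)) / (4 * sin t - sin (2 * t))"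
  proof -
    define r where "r = u\<^sup>2 + 1"
    have r: "r > 0" by (simp add: r_def add_nonneg_pos)
    have "4 - 4 * cos t + cos (2 * t) = 3 - 4 * cos t + 2 * (cos t)\<^sup>2"
      unfolding cos_double_cos by simp
    also have "\<dots> = (3 * r\<^sup>2 - 4 * (u\<^sup>2 - 1) * r + 2 * (u\<^sup>2 - 1)\<^sup>2) / r\<^sup>2"
      unfolding h(2) r_def[symmetric] power_divide using r
      by (simp add: diff_divide_distrib add_divide_distrib power2_eq_square[of r])
    also have "3 * r\<^sup>2 - 4 * (u\<^sup>2 - 1) * r + 2 * (u\<^sup>2 - 1)\<^sup>2 = u ^ 4 + 2 * u\<^sup>2 + 9"
      unfolding r_def by algebra
    finally have n: "4 - 4 * cos t + cos (2 * t) = (u ^ 4 + 2 * u\<^sup>2 + 9) / r\<^sup>2" .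
    have "4 * sin t - sin (2 * t) = 2 * sin t * (2 - cos t)"
      unfolding sin_double by (simp add: algebra_simps)
    also have "2 - cos t = (u\<^sup>2 + 3) / r"
      unfolding h(2) r_def[symmetric] using r by (simp add: r_def field_simps)
    also have "2 * sin t * ((u\<^sup>2 + 3) / r) = 4 * u * (u\<^sup>2 + 3) / r\<^sup>2"
      unfolding h(3) r_def[symmetric] by (simp add: power2_eq_square)
    finally show ?thesis unfolding n using r by simp
  qed
  finally have cot: "cot t' = (4 - 4 * cos t + cos (2 * t)) / (4 * sin t - sin (2 * t))" .
  have angles: "brocard_angle T = acot u \<and> brocard_angle (second_brocard_triangle T) = acot u'"
    if "T \<in> three_periodics (porism_of u v)" for T
    using that brocard_angle_three_periodics[OF v] brocard_angle_three_periodics[OF w(1-3)]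
      second_brocard_triangle_image[OF v u' v'] by blast
  show ?thesis
    unfolding B(1)
  \<comment> \<open>The witnesses are \<open>t'\<close>, the angles \<open>acot u\<close> and
    \<open>acot u'\<close>, and their cotangents \<open>u\<close> and \<open>u'\<close>.\<close>
  proof (intro conjI exI ballI)
    show "brocard_porism (porism_of u v)" using brocard_porism_porism_of[OF v] .
    show "t < t'" "t' < pi / 3" by fact+
    show "brocard_porism (porism_B t')" unfolding B(2) using brocard_porism_porism_of[OF w(1-3)] .
    show "porism_B t' \<noteq> porism_of u v" unfolding B(2) using porism_of_neq[OF v w(1,2)] w(4) by simp
    show "second_brocard_triangle ` three_periodics (porism_of u v) = three_periodics (porism_B t')"
      unfolding B(2) by (rule second_brocard_triangle_image[OF v u' v'])
    show "brocard_angle T = acot u" "brocard_angle (second_brocard_triangle T) = acot u'"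
      if "T \<in> three_periodics (porism_of u v)" for T using angles that by blast+
    show "u = cot (acot u)" "u' = cot (acot u')" by (simp_all add: cot_acot)
    show "cot t' = (4 - 4 * cos t + cos (2 * t)) / (4 * sin t - sin (2 * t))" by (fact cot)
    show "cot (t' / 2) = u'" using ct' by simp
    show "u' = (u\<^sup>2 + 3) / (2 * u)" by (fact u')
  qed
qed

end
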